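(* Let $a\in L^\infty(0,1)$ satisfy $\int_0^1a(x)\,dx<0$ and suppose there is $z\in(0,1)$ such that $a(x)>0$ for a.e. $x\in(0,z)$ and $a(x)<0$ for a.e. $x\in(z,1)$. Suppose there exist constants $A>0$, $B>0$ and $\eta>0$ such that $$a(x)\ge A\ \text{ for a.e. }x\in(z-\eta,z)\quad\text{and}\quad a(x)\le-B\ \text{ for a.e. }x\in(z,z+\eta).$$ Let $x_\omega$ be the unique point of $(z,1)$ with $\int_0^{x_\omega}a(x)\,dx=0$, and suppose that $\operatorname*{ess\,sup}_{[z+\varepsilon,x_\omega]}a<0$ for all small $\varepsilon>0$. Let $f\in\mathcal C(\mathbb R)$ satisfy $f(0)=0$, $f(u)>0$ for $u>0$, and, for some constants $h>0$, $p>0$ and $q\in(0,1)$, $$\lim_{u\to0^+}\frac{f(u)}{u^p}=1,\qquad \lim_{u\to\infty}\frac{f(u)}{u^{-q}}=h.$$ Let $M>0$ be the maximal number with $f(M)=\max_{u\ge0}f(u)$, and suppose that $f\in\mathcal C^1[M,\infty)$, $f$ is increasing in $(0,M)$ and decreasing in $(M,\infty)$. Then the problem $$-\left(\frac{u'}{\sqrt{1+(u')^2}}\right)'=\lambda a(x)f(u),\quad 0<x<1,\qquad u'(0)=u'(1)=0,$$ cannot admit positive regular solutions separated away from zero for sufficiently large $\lambda>0$; that is, there is no sequence $\{(\lambda_n,u_n)\}_{n\ge1}$, with $u_n$ a positive regular solution for $\lambda=\lambda_n$, such that $\lim_{n\to\infty}\lambda_n=\infty$ and $\liminf_{n\to\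infty}u_n(0)>0$.
   Context: A regular solution is a function $u\in W^{2,1}(0,1)$ satisfying the equation a.e. in $(0,1)$ and the boundary conditions; it is positive if $\min u\ge0$ and $\max u>0$. Under the sign condition on $a$, positive regular solutions (with $\lambda>0$) are decreasing in $[0,1]$, so that $u(0)=\|u\|_{L^\infty(0,1)}$. "Increasing" and "decreasing" for $f$ are meant in the strict sense. *)

theory Defs
  imports "HOL-Analysis.Analysis" "HOL-Probability.Essential_Supremum"
begin

text \<open>
  Functions on an interval are represented by total functions \<open>real \<Rightarrow> real\<close> whose values outside
  that interval play no role; equivalence classes modulo null sets are replaced by representatives.
\<close>

definition L_infinity :: "real set \<Rightarrow> (real \<Rightarrow> real) set" where
  "L_infinity I =
     {a \<in> borel_measurable (lebesgue_on I). \<exists>C. AE x\<in>I in lebesgue. \<bar>a x\<bar> \<le> C}"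

definition test_functions :: "real set \<Rightarrow> (real \<Rightarrow> real) set" where
  "test_functions I =
     {\<phi>. \<phi> C1_differentiable_on UNIV \<and>
         compact (closure {x. \<phi> x \<noteq> 0}) \<and> closure {x. \<phi> x \<noteq> 0} \<subseteq> I}"

text \<open>
  Test functions are of class \<open>C\<^sup>1\<close> with compact support, the usual convention for Sobolev spaces on
  an interval; \<open>C\<^sup>\<infinity>\<close> test functions yield the same weak derivatives.
\<close>

definition has_weak_derivative ::
  "(real \<Rightarrow> real) \<Rightarrow> (real \<Rightarrow> real) \<Rightarrow> real set \<Rightarrow> bool" where
  "has_weak_derivative u v I \<longleftrightarrow>
     set_integrable lebesgue I u \<and> set_integrable lebesgue I v \<and>
     (\<forall>\<phi>\<in>test_functions I.
        (LINT x:I|lebesgue. u x * deriv \<phi> x) = - (LINT x:I|lebesgue. v x * \<phi> x))"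

definition W11 :: "real set \<Rightarrow> (real \<Rightarrow> real) set" where
  "W11 I = {u. \<exists>v. has_weak_derivative u v I}"

definition W21 :: "real set \<Rightarrow> (real \<Rightarrow> real) set" where
  "W21 I = {u. \<exists>v\<in>W11 I. has_weak_derivative u v I}"

text \<open>
  A regular solution is identified with its representative that is continuous on \<open>[0,1]\<close>.  That
  representative is of class \<open>C\<^sup>1\<close> on \<open>[0,1]\<close>, so the boundary conditions are stated with one-sided
  classical derivatives.  Inside the equation, \<open>v\<close> is \<open>u'\<close> and \<open>w\<close> is the (weak) derivative of
  \<open>u' / sqrt (1 + (u')\<^sup>2)\<close>, both determined up to a null set.
\<close>

definition regular_solution ::
  "(real \<Rightarrow> real) \<Rightarrow> (real \<Rightarrow> real) \<Rightarrow> real \<Rightarrow> (real \<Rightarrow> real) \<Rightarrow> bool" where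
  "regular_solution a f lam u \<longleftrightarrow>
     continuous_on {0..1} u \<and> u \<in> W21 {0<..<1} \<and>
     (\<exists>v w. has_weak_derivative u v {0<..<1} \<and>
            has_weak_derivative (\<lambda>x. v x / sqrt (1 + (v x)\<^sup>2)) w {0<..<1} \<and>
            (AE x\<in>{0<..<1} in lebesgue. - w x = lam * a x * f (u x))) \<and>
     (u has_real_derivative 0) (at 0 within {0..1}) \<and>
     (u has_real_derivative 0) (at 1 within {0..1})"

definition positive_regular_solution ::
  "(real \<Rightarrow> real) \<Rightarrow> (real \<Rightarrow> real) \<Rightarrow> real \<Rightarrow> (real \<Rightarrow> real) \<Rightarrow> bool" where
  "positive_regular_solution a f lam u \<longleftrightarrow>
     regular_solution a f lam u \<and> (\<forall>x\<in>{0..1}. u x \<ge> 0) \<and> (\<exists>x\<in>{0..1}. u x > 0)"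

end

theory Submission
  imports Defs "HOL-Real_Asymp.Real_Asymp"
begin

text \<open>
  Write \<open>\<psi> = u' / sqrt (1 + u'\<^sup>2)\<close>, so that \<open>\<psi>' = - \<lambda> a f(u)\<close>, \<open>\<bar>\<psi>\<bar> < 1\<close>, and \<open>\<psi>\<close> vanishes at both
  end points.  Because \<open>a\<close> changes sign once, from plus to minus at \<open>z\<close>, the solution is nonincreasing,
  concave on \<open>[0,z]\<close> and convex on \<open>[z,1]\<close>.  Suppose that \<open>u(0) \<ge> \<delta> > 0\<close> with \<open>\<lambda>\<close> large.

  First, \<open>u(0)\<close> is large.  Concavity keeps \<open>u \<ge> \<kappa> \<delta>\<close> on a fixed interval to the left of \<open>z\<close>.  If \<open>u(0)\<close>
  were bounded, \<open>f(u)\<close> would be bounded below on that interval, and the integral of \<open>\<lambda> a f(u)\<close> over it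
  would exceed 1, whereas it equals a decrease of \<open>\<psi>\<close>, whose values lie in \<open>(-1,0]\<close>.

  Second, \<open>u\<close> is still above \<open>M\<close> at \<open>x\<^sub>\<omega>\<close>.  The energy \<open>E = 1 / sqrt (1 + u'\<^sup>2)\<close> takes values in \<open>(0,1]\<close>
  and satisfies \<open>E' = \<lambda> a f(u) u'\<close>.  Where \<open>\<bar>a\<bar>\<close> is bounded below by a constant \<open>k\<close>, the primitive \<open>F\<close> of
  \<open>f\<close> therefore drops along \<open>u\<close> by at most \<open>1 / (\<lambda> k)\<close> (lemma \<open>energy_inequality\<close>).  Such a bound is
  available just to the left of \<open>z\<close> and on all of \<open>(z, x\<^sub>\<omega>)\<close>.  As \<open>f\<close> decays like \<open>u\<^bsup>-q\<^esup>\<close> with \<open>q < 1\<close>, \<open>F\<close>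
  is unbounded, so a large \<open>u(0)\<close> forces a large \<open>u(x\<^sub>\<omega>)\<close>.

  Third, this is impossible.  On \<open>[0, x\<^sub>\<omega>]\<close> the values of \<open>u\<close> lie where \<open>f\<close> is decreasing, so \<open>f(u)\<close> is
  nondecreasing in \<open>x\<close> and the integral of \<open>a f(u)\<close> over \<open>[0, x\<^sub>\<omega>]\<close> is at most \<open>f(u(z))\<close> times that of
  \<open>a\<close>, which is 0.  Hence \<open>\<psi>(x\<^sub>\<omega>) \<ge> 0\<close>, and by the sign and monotonicity of \<open>\<psi>\<close> it vanishes on
  \<open>[x\<^sub>\<omega>, 1]\<close>.  There \<open>u\<close> is a positive constant, and integrating the equation shows that \<open>a\<close> has
  integral 0 over \<open>[x\<^sub>\<omega>, 1]\<close>.  Then \<open>a\<close> has integral 0 over \<open>(0,1)\<close>, a contradiction.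

  Before this argument can start, the weak formulation has to be turned into a classical one: a
  function with a weak derivative on \<open>(0,1)\<close> is almost everywhere a primitive of it
  (\<open>weak_derivative_imp_primitive\<close>), and hence \<open>u\<close> is of class \<open>C\<^sup>1\<close> on \<open>[0,1]\<close> and \<open>\<psi>\<close> is a primitive
  of \<open>- \<lambda> a f(u)\<close> (\<open>regular_solution_is_C1\<close>).  The coefficient \<open>a\<close> is merely bounded, so \<open>\<psi>\<close> and \<open>E\<close>
  need not be differentiable everywhere; the differential inequality for \<open>E\<close> is replaced by an estimate
  of right difference quotients (\<open>nonincreasing_if_right_difference_quotients\<close>).
\<close>

section \<open>Integrals and almost everywhere relations\<close>

lemma AE_on_Icc_if_Ioo:
  assumes "AE x\<in>{a<..<b::real} in lebesgue. P x"
  shows "AE x\<in>{a..b} in lebesgue. P x"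
proof -
  have "AE x in lebesgue. x \<noteq> a" "AE x in lebesgue. x \<noteq> b"
    by (intro AE_completion AE_lborel_singleton)+
  with assms show ?thesis by eventually_elim auto
qed

lemma integral_eq_if_AE_eq:
  fixes p q :: "real \<Rightarrow> real"
  assumes "AE x\<in>S in lebesgue. p x = q x" and "T \<subseteq> S"
  shows "integral T p = integral T q"
proof -
  obtain N where N: "N \<in> null_sets lebesgue" "{x. \<not> (x \<in> S \<longrightarrow> p x = q x)} \<subseteq> N"
    using assms(1) by (auto simp: eventually_ae_filter)
  show ?thesis
    by (rule integral_spike[of N]) (use N assms(2) in \<open>auto simp: negligible_iff_null_sets\<close>)
qed

lemma integral_le_if_AE_le:
  fixes p q :: "real \<Rightarrow> real"
  assumes p: "p integrable_on S" and q: "q integrable_on S"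
    and le: "AE x\<in>S in lebesgue. p x \<le> q x"
  shows "integral S p \<le> integral S q"
proof -
  have eq: "AE x\<in>S in lebesgue. q x = max (p x) (q x)"
    using le by eventually_elim auto
  then obtain N where N: "N \<in> null_sets lebesgue" "{x. \<not> (x \<in> S \<longrightarrow> q x = max (p x) (q x))} \<subseteq> N"
    by (auto simp: eventually_ae_filter)
  have "(\<lambda>x. max (p x) (q x)) integrable_on S"
    by (rule integrable_spike[OF q, of N]) (use N in \<open>auto simp: negligible_iff_null_sets\<close>)
  then have "integral S p \<le> integral S (\<lambda>x. max (p x) (q x))"
    by (rule integral_le[OF p]) auto
  then show ?thesis using integral_eq_if_AE_eq[OF eq] by simp
qed

text \<open>
  The set where two continuous functions differ is open in \<open>(a,b)\<close>, and a nonempty open set is not a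
  null set; the end points follow by continuity.
\<close>

lemma continuous_eq_if_AE_eq:
  fixes p q :: "real \<Rightarrow> real"
  assumes p: "continuous_on {a..b} p" and q: "continuous_on {a..b} q" and ab: "a < b"
    and AE: "AE x\<in>{a..b} in lebesgue. p x = q x" and x: "x \<in> {a..b}"
  shows "p x = q x"
proof -
  let ?D = "{a<..<b} \<inter> {x. p x - q x \<noteq> 0}"
  have "continuous_on {a<..<b} (\<lambda>x. p x - q x)"
    by (intro continuous_intros continuous_on_subset[OF p] continuous_on_subset[OF q]) auto
  then have "open ({a<..<b} \<inter> (\<lambda>x. p x - q x) -` (- {0}))"
    by (intro continuous_open_preimage) auto
  then have "open ?D" by (simp add: vimage_def Compl_eq)
  moreover have "negligible ?D"
  proof -
    obtain N where N: "N \<in> null_sets lebesgue" "{x. \<not> (x \<in> {a..b} \<longrightarrow> p x = q x)} \<subseteq> N"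
      using AE by (auto simp: eventually_ae_filter)
    have "negligible N" using N by (simp add: negligible_iff_null_sets)
    then show ?thesis by (rule negligible_subset) (use N in auto)
  qed
  ultimately have "?D = {}" using open_not_negligible by blast
  then have "p x - q x = 0" if "x \<in> {a<..<b}" for x using that by blast
  then have "p x - q x = 0"
    using continuous_constant_on_closure[of "{a<..<b}" "\<lambda>x. p x - q x" 0 x] ab x p q
    by (simp add: continuous_intros)
  then show ?thesis by simp
qed

text \<open>
  The sets over which the integral of \<open>h\<close> vanishes form a Dynkin system that contains the half-lines.
  So it contains all Borel sets, among them the sets where \<open>h\<close> is positive or negative.
\<close>

lemma interval_integrals_zero_imp_AE_zero:
  fixes h :: "real \<Rightarrow> real"
  assumes h: "h absolutely_integrable_on {a..b}"
    and zero: "\<And>t. a \<le> t \<Longrightarrow> t \<le> b \<Longrightarrow> integral {a..t} h = 0"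
  shows "AE x\<in>{a..b} in lebesgue. h x = 0"
proof -
  \<comment> \<open>\<open>h\<close> is only Lebesgue measurable; a Borel version of its extension
    by 0 is integrable over \<open>lborel\<close>.\<close>
  define k where "k = (\<lambda>x. indicat_real {a..b} x * h x)"
  have k: "integrable lebesgue k"
    using h unfolding set_integrable_def k_def by simp
  then obtain k' where k': "k' \<in> borel_measurable lborel" "AE x in lborel. k x = k' x"
    using completion_ex_borel_measurable_real by blast
  have AEk: "AE x in lebesgue. k x = k' x"
    using k'(2) AE_completion by blast
  have ik': "integrable lebesgue k'"
    using k AEk k'(1) by (subst integrable_cong_AE[symmetric, of k]) (auto simp: measurable_completion)
  then have ilk': "integrable lborel k'"
    using k'(1) integrable_completion by blast
  have meas: "k \<in> borel_measurable lebesgue" "k' \<in> borel_measurable lebesgue"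
    using k ik' by auto
  have restrict: "(LINT x:S|lborel. k' x) = (LINT x:S|lebesgue. k x)" if "S \<in> sets borel" for S
  proof -
    have "(LINT x:S|lborel. k' x) = (LINT x:S|lebesgue. k' x)"
      unfolding set_lebesgue_integral_def
      by (rule integral_completion[symmetric]) (use k'(1) that in measurable)
    also have "\<dots> = (LINT x:S|lebesgue. k x)"
      unfolding set_lebesgue_integral_def
      using AEk that by (intro integral_cong_AE) (auto intro!: borel_measurable_times meas borel_measurable_indicator)
    finally show ?thesis .
  qed
  have base: "(LINT x:{..t}|lborel. k' x) = 0" for t
  proof -
    have "(LINT x:{..t}|lborel. k' x) = (LINT x:{..t}|lebesgue. k x)"
      by (rule restrict) auto
    also have "\<dots> = (LINT x:{a..min t b}|lebesgue. h x)"
      unfolding set_lebesgue_integral_def k_def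
      by (rule Bochner_Integration.integral_cong) (auto simp: indicator_def)
    also have "\<dots> = integral {a..min t b} h"
      by (intro set_lebesgue_integral_eq_integral set_integrable_subset[OF h]) auto
    also have "\<dots> = 0"
      using zero[of "min t b"] by (cases "a \<le> min t b") auto
    finally show ?thesis .
  qed
  have sint: "set_integrable lborel S k'" if "S \<in> sets borel" for S
    using integrable_mult_indicator[OF _ ilk', of S] that by (simp add: set_integrable_def)
  \<comment> \<open>The complement step of the induction needs the integral over the whole line.\<close>
  have whole: "(LINT x:UNIV|lborel. k' x) = 0"
  proof -
    have "(LINT x:UNIV|lborel. k' x) = (LINT x:{a..b}|lebesgue. h x)"
      using restrict[of UNIV] by (simp add: set_lebesgue_integral_def k_def)
    also have "\<dots> = integral {a..b} h"
      by (intro set_lebesgue_integral_eq_integral h)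
    also have "\<dots> = 0"
      using zero[of b] by (cases "a \<le> b") auto
    finally show ?thesis .
  qed
  have all: "(LINT x:S|lborel. k' x) = 0" if "S \<in> sets borel" for S
  proof -
    have "Int_stable (range (\<lambda>t::real. {..t}))"
      by (auto simp: Int_stable_def)
    moreover have "range (\<lambda>t::real. {..t}) \<subseteq> Pow UNIV" by simp
    moreover have "S \<in> sigma_sets UNIV (range (\<lambda>t::real. {..t}))"
      using that by (simp add: borel_eq_atMost)
    ultimately show ?thesis
    proof (induction S rule: sigma_sets_induct_disjoint)
      case (compl S)
      then have S: "S \<in> sets borel" by (simp add: borel_eq_atMost)
      have "(LINT x:S \<union> (UNIV - S)|lborel. k' x)
          = (LINT x:S|lborel. k' x) + (LINT x:UNIV - S|lborel. k' x)"
        using S by (intro set_integral_Un sint) (auto intro: borel_comp simp flip: Compl_eq_Diff_UNIV)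
      then show ?case using whole compl by simp
    next
      case (union T)
      then have T: "T i \<in> sets borel" for i
        by (auto simp: borel_eq_atMost)
      with union show ?case
        by (subst lebesgue_integral_countable_add) (auto intro!: sint simp: disjoint_family_on_def)
    next
      case empty
      then show ?case by (simp add: set_lebesgue_integral_def)
    qed (auto simp: base)
  qed
  have "AE x in lborel. k' x = 0"
    using density_unique_real[of lborel k' "\<lambda>_. 0"] all ilk' by simp
  then have "AE x in lebesgue. k' x = 0"
    using AE_completion by blast
  with AEk show ?thesis
    by eventually_elim (auto simp: k_def)
qed

section \<open>Monotonicity from right difference quotients\<close>

text \<open>
  The points that can be reached from \<open>a\<close> with growth at most of slope \<open>e\<close> form a compact set.  Its
  largest element is \<open>b\<close>, as the hypothesis would otherwise allow a further step to the right.  The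
  pointwise bound on right difference quotients takes the place of a derivative in the two
  applications, where the functions are built from integrals of merely integrable functions.
\<close>

lemma nonincreasing_if_right_difference_quotients:
  fixes H :: "real \<Rightarrow> real"
  assumes ab: "a \<le> b" and H: "continuous_on {a..b} H"
    and quot: "\<And>x e. \<lbrakk>a \<le> x; x < b; e > 0\<rbrakk> \<Longrightarrow> \<forall>\<^sub>F y in at_right x. H y - H x \<le> e * (y - x)"
  shows "H b \<le> H a"
proof -
  have "H b \<le> H a + e * (b - a)" if e: "e > 0" for e
  proof -
    \<comment> \<open>The points up to which \<open>H\<close> has grown with mean slope at most
      \<open>e\<close>.\<close>
    define S where "S = {y\<in>{a..b}. H y - e * (y - a) \<le> H a}"
    have "closed S"
      unfolding S_def
      by (intro continuous_closed_preimage_constant continuous_on_closed_Collect_le continuous_intros H closed_atLeastAtMost)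
    then have "compact S"
      unfolding compact_eq_bounded_closed S_def by (auto intro: bounded_subset[OF bounded_closed_interval])
    moreover have "a \<in> S" using ab by (simp add: S_def)
    ultimately obtain s where s: "s \<in> S" "\<And>y. y \<in> S \<Longrightarrow> y \<le> s"
      using compact_attains_sup[of S] by blast
    have "s = b"
    proof (rule ccontr)
      assume "s \<noteq> b"
      then have sb: "a \<le> s" "s < b" using s(1) by (auto simp: S_def)
      have "\<forall>\<^sub>F y in at_right s. H y - H s \<le> e * (y - s) \<and> s < y \<and> y < b"
        using quot[OF sb e] sb(2) by (auto simp: eventually_conj_iff eventually_at_right_less eventually_at_right[OF sb(2)])
      then obtain y where y: "H y - H s \<le> e * (y - s)" "s < y" "y < b"
        using eventually_happens' trivial_limit_at_right_real by (metis (mono_tags, lifting))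
      then have "y \<in> S" using s(1) by (auto simp: S_def algebra_simps)
      with s(2) y(2) show False by force
    qed
    then show ?thesis using s(1) by (simp add: S_def algebra_simps)
  qed
  then have lim: "\<And>e. e > 0 \<Longrightarrow> H b - H a \<le> e * (b - a)" by force
  show ?thesis
  proof (cases "a = b")
    case False
    then have "b - a > 0" using ab by simp
    then have "H b - H a \<le> e" if "e > 0" for e
      using lim[of "e / (b - a)"] that by simp
    then show ?thesis using field_le_epsilon[of "H b" "H a"] by force
  qed simp
qed

text \<open>
  Both sides, as functions of the upper end point, have increments that differ by at most
  \<open>2 C (N(y) - N(x)) (y - x)\<close>, where \<open>N\<close> is the continuous primitive of \<open>\<bar>v\<bar>\<close> and \<open>C\<close> bounds \<open>\<bar>g\<bar>\<close>.  This is
  \<open>o(y - x)\<close>, so the difference of the two sides is constant.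
\<close>

lemma integral_by_parts_absolutely_integrable:
  fixes v g \<Phi> :: "real \<Rightarrow> real"
  assumes ab: "a \<le> b" and v: "v absolutely_integrable_on {a..b}"
    and g: "continuous_on {a..b} g"
    and \<Phi>: "\<And>x. x \<in> {a..b} \<Longrightarrow> (\<Phi> has_real_derivative g x) (at x within {a..b})"
  shows "integral {a..b} (\<lambda>x. v x * \<Phi> x)
    = \<Phi> b * integral {a..b} v - integral {a..b} (\<lambda>x. integral {a..x} v * g x)"
proof -
  have \<Phi>c: "continuous_on {a..b} \<Phi>"
    by (rule DERIV_continuous_on[OF \<Phi>])
  have "(\<lambda>x. \<Phi> x * v x) absolutely_integrable_on {a..b}"
    using v \<Phi>c
    by (intro absolutely_integrable_bounded_measurable_product_real)
       (auto intro!: continuous_imp_measurable_on_sets_lebesgue compact_imp_bounded compact_continuous_image)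
  then have v\<Phi>: "(\<lambda>x. v x * \<Phi> x) integrable_on {a..b}"
    using set_lebesgue_integral_eq_integral(1) by (simp add: mult.commute)
  define P where "P = (\<lambda>x. integral {a..x} v)"
  define N where "N = (\<lambda>x. integral {a..x} (\<lambda>t. \<bar>v t\<bar>))"
  have vi: "v integrable_on {a..b}" "(\<lambda>t. \<bar>v t\<bar>) integrable_on {a..b}"
    using v by (auto simp: absolutely_integrable_on_def)
  have Pc: "continuous_on {a..b} P" and Nc: "continuous_on {a..b} N"
    unfolding P_def N_def by (intro indefinite_integral_continuous_1 vi)+
  have Pgc: "continuous_on {a..b} (\<lambda>x. P x * g x)" by (intro continuous_intros Pc g)
  obtain C where C: "C > 0" "\<And>x. x \<in> {a..b} \<Longrightarrow> \<bar>g x\<bar> \<le> C"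
    using compact_continuous_image[OF g] compact_imp_bounded bounded_pos
    by (metis (no_types, lifting) compact_Icc image_eqI real_norm_def)
  \<comment> \<open>The defect of the formula on \<open>{a..y}\<close>; it vanishes at
    \<open>a\<close> and is shown to be constant.\<close>
  define D where "D = (\<lambda>y. integral {a..y} (\<lambda>x. v x * \<Phi> x) - \<Phi> y * P y + integral {a..y} (\<lambda>x. P x * g x))"
  have Dc: "continuous_on {a..b} D"
    unfolding D_def
    by (intro continuous_intros indefinite_integral_continuous_1 v\<Phi> \<Phi>c Pc integrable_continuous_real Pgc)
  have D_incr: "\<bar>D y - D x\<bar> \<le> 2 * C * (N y - N x) * (y - x)" if xy: "a \<le> x" "x \<le> y" "y \<le> b" for x y
  proof -
    have sub: "{x..y} \<subseteq> {a..b}" using xy by auto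
    have split: "integral {a..y} f - integral {a..x} f = integral {x..y} f" if "f integrable_on {a..b}" for f :: "real \<Rightarrow> real"
      using Henstock_Kurzweil_Integration.integral_combine[of a x y f] xy
        integrable_on_subinterval[OF that, of a y] by auto
    have PN: "\<bar>P t - P s\<bar> \<le> N t - N s" if "x \<le> s" "s \<le> t" "t \<le> y" for s t
    proof -
      have *: "{s..t} \<subseteq> {a..b}" using that xy by auto
      have "P t - P s = integral {s..t} v"
        unfolding P_def using Henstock_Kurzweil_Integration.integral_combine[of a s t v] that xy
        integrable_on_subinterval[OF vi(1), of a t] by auto
      moreover have "N t - N s = integral {s..t} (\<lambda>t. \<bar>v t\<bar>)"
        unfolding N_def using Henstock_Kurzweil_Integration.integral_combine[of a s t "\<lambda>t. \<bar>v t\<bar>"] that xy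
        integrable_on_subinterval[OF vi(2), of a t] by auto
      moreover have "norm (integral {s..t} v) \<le> integral {s..t} (\<lambda>t. \<bar>v t\<bar>)"
        by (rule integral_norm_bound_integral) (use vi integrable_on_subinterval[OF _ *] in auto)
      ultimately show ?thesis by simp
    qed
    have \<Phi>g: "(g has_integral (\<Phi> t - \<Phi> s)) {s..t}" if "x \<le> s" "s \<le> t" "t \<le> y" for s t
      by (rule fundamental_theorem_of_calculus)
         (use that xy in \<open>auto simp: has_real_derivative_iff_has_vector_derivative[symmetric] intro!: DERIV_subset[OF \<Phi>]\<close>)
    have \<Phi>lip: "\<bar>\<Phi> t - \<Phi> x\<bar> \<le> C * (y - x)" if "t \<in> {x..y}" for t
    proof -
      have "norm (\<Phi> t - \<Phi> x) \<le> C * measure lborel (cbox x t)"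
        by (rule has_integral_bound[of _ g]) (use \<Phi>g[of x t] that C xy in auto)
      also have "\<dots> \<le> C * (y - x)" using that C by simp
      finally show ?thesis by simp
    qed
    have I1: "(\<lambda>t. v t * (\<Phi> t - \<Phi> x)) integrable_on {x..y}"
      using integrable_diff[OF integrable_on_subinterval[OF v\<Phi> sub] integrable_on_mult_left[OF integrable_on_subinterval[OF vi(1) sub], of "\<Phi> x"]]
      by (simp add: algebra_simps)
    have I2: "(\<lambda>t. (P t - P y) * g t) integrable_on {x..y}"
      by (intro integrable_continuous_real continuous_intros continuous_on_subset[OF Pc sub] continuous_on_subset[OF g sub])
    have "D y - D x = integral {x..y} (\<lambda>t. v t * \<Phi> t) - (\<Phi> y * P y - \<Phi> x * P x) + integral {x..y} (\<lambda>t. P t * g t)"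
      unfolding D_def using split[OF v\<Phi>] split[OF integrable_continuous_real[OF Pgc]] by simp
    also have "integral {x..y} (\<lambda>t. v t * \<Phi> t) = integral {x..y} (\<lambda>t. v t * (\<Phi> t - \<Phi> x)) + (P y - P x) * \<Phi> x"
    proof -
      have "integral {x..y} (\<lambda>t. v t * (\<Phi> t - \<Phi> x) + v t * \<Phi> x)
        = integral {x..y} (\<lambda>t. v t * (\<Phi> t - \<Phi> x)) + integral {x..y} (\<lambda>t. v t * \<Phi> x)"
        by (intro Henstock_Kurzweil_Integration.integral_add I1 integrable_on_mult_left integrable_on_subinterval[OF vi(1) sub])
      then show ?thesis using split[OF vi(1)] by (simp add: P_def algebra_simps)
    qed
    also have "integral {x..y} (\<lambda>t. P t * g t) = integral {x..y} (\<lambda>t. (P t - P y) * g t) + P y * (\<Phi> y - \<Phi> x)"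
    proof -
      have gi: "g integrable_on {x..y}" "integral {x..y} g = \<Phi> y - \<Phi> x"
        using \<Phi>g[of x y] xy by (auto simp: has_integral_integrable_integral)
      have "integral {x..y} (\<lambda>t. (P t - P y) * g t + P y * g t)
        = integral {x..y} (\<lambda>t. (P t - P y) * g t) + integral {x..y} (\<lambda>t. P y * g t)"
        by (intro Henstock_Kurzweil_Integration.integral_add I2 integrable_on_mult_right gi)
      then show ?thesis using gi by (simp add: algebra_simps)
    qed
    \<comment> \<open>The first-order terms have cancelled; each remaining integrand is a product of
      two small factors.\<close>
    finally have "D y - D x = integral {x..y} (\<lambda>t. v t * (\<Phi> t - \<Phi> x)) + integral {x..y} (\<lambda>t. (P t - P y) * g t)"
      by (simp add: algebra_simps)
    moreover have "norm (integral {x..y} (\<lambda>t. v t * (\<Phi> t - \<Phi> x))) \<le> integral {x..y} (\<lambda>t. C * (y - x) * \<bar>v t\<bar>)"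
    proof (rule integral_norm_bound_integral[OF I1])
      show "(\<lambda>t. C * (y - x) * \<bar>v t\<bar>) integrable_on {x..y}"
        by (intro integrable_on_mult_right integrable_on_subinterval[OF vi(2) sub])
      show "norm (v t * (\<Phi> t - \<Phi> x)) \<le> C * (y - x) * \<bar>v t\<bar>" if "t \<in> {x..y}" for t
        using mult_left_mono[OF \<Phi>lip[OF that] abs_ge_zero[of "v t"]] by (simp add: abs_mult mult_ac)
    qed
    moreover have "integral {x..y} (\<lambda>t. C * (y - x) * \<bar>v t\<bar>) = C * (y - x) * (N y - N x)"
      using split[OF vi(2)] by (simp add: N_def)
    moreover have "norm (integral {x..y} (\<lambda>t. (P t - P y) * g t)) \<le> ((N y - N x) * C) * (y - x)"
    proof (rule integral_bound)
      show "continuous_on {x..y} (\<lambda>t. (P t - P y) * g t)"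
        by (intro continuous_intros continuous_on_subset[OF Pc sub] continuous_on_subset[OF g sub])
      show "norm ((P t - P y) * g t) \<le> (N y - N x) * C" if "t \<in> {x..y}" for t
      proof -
        have "\<bar>P t - P y\<bar> \<le> N y - N x"
          using PN[of t y] PN[of x t] that by auto
        then show ?thesis using C(2)[of t] sub that by (auto simp: abs_mult intro!: mult_mono)
      qed
    qed (use xy in auto)
    ultimately show ?thesis by (simp add: algebra_simps) 
  qed
  have ev: "\<forall>\<^sub>F y in at_right x. \<bar>D y - D x\<bar> \<le> e * (y - x)" if x: "a \<le> x" "x < b" and e: "e > 0" for x e
  proof -
    have "(N \<longlongrightarrow> N x) (at x within {a..b})"
      using Nc x by (auto simp: continuous_on_def)
    then have "(N \<longlongrightarrow> N x) (at x within {x..b})"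
      by (rule tendsto_within_subset) (use x in auto)
    then have "(N \<longlongrightarrow> N x) (at_right x)"
      using x by (simp add: at_within_Icc_at_right)
    then have "\<forall>\<^sub>F y in at_right x. \<bar>N y - N x\<bar> < e / (2 * C)"
      using e C(1) tendstoD[of N "N x" "at_right x" "e / (2 * C)"] by (simp add: dist_real_def)
    moreover have "\<forall>\<^sub>F y in at_right x. x < y \<and> y < b"
      using x(2) by (auto simp: eventually_conj_iff eventually_at_right_less eventually_at_right[OF x(2)])
    ultimately show ?thesis
    proof eventually_elim
      case (elim y)
      then have "2 * C * (N y - N x) \<le> e" using C(1) by (simp add: field_simps abs_less_iff)
      then have "2 * C * (N y - N x) * (y - x) \<le> e * (y - x)"
        using elim by (intro mult_right_mono) auto
      moreover have "\<bar>D y - D x\<bar> \<le> 2 * C * (N y - N x) * (y - x)"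
        using elim x by (intro D_incr) auto
      ultimately show ?case by linarith
    qed
  qed
  have "D b \<le> D a"
    by (rule nonincreasing_if_right_difference_quotients[OF ab Dc], rule eventually_mono[OF ev]) auto
  moreover have "- D b \<le> - D a"
    by (rule nonincreasing_if_right_difference_quotients[OF ab, of "\<lambda>x. - D x"], intro continuous_intros Dc, rule eventually_mono[OF ev]) auto
  moreover have "D a = 0" by (simp add: D_def P_def)
  ultimately show ?thesis by (simp add: D_def P_def)
qed

section \<open>Functions with a weak derivative are primitives\<close>

text \<open>
  The primitive of \<open>g\<close> from 0 vanishes up to \<open>r\<close>, and because \<open>g\<close> has mean zero it vanishes again from
  \<open>1 - r\<close> on.
\<close>

lemma continuous_imp_test_function:
  fixes g :: "real \<Rightarrow> real"
  assumes g: "continuous_on UNIV g" and r: "0 < r" "r < 1/2"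
    and supp: "\<And>x. x \<notin> {r<..<1-r} \<Longrightarrow> g x = 0" and mean: "integral {0..1} g = 0"
  defines "\<phi> \<equiv> (\<lambda>x. integral {0..x} g)"
  shows "\<phi> \<in> test_functions {0<..<1}" and "\<And>x. (\<phi> has_real_derivative g x) (at x)"
proof -
  have gc: "continuous_on S g" for S using g continuous_on_subset by blast
  have int: "g integrable_on {s..t}" for s t by (rule integrable_continuous_real[OF gc])
  have lo: "\<phi> x = 0" if "x \<le> r" for x
    unfolding \<phi>_def
    by (rule integral_unique, rule has_integral_is_0) (use that supp in auto)
  have hi: "\<phi> x = 0" if "1 - r \<le> x" for x
  proof -
    have *: "integral {1-r..t} g = 0" for t
      by (rule integral_unique, rule has_integral_is_0) (use supp in auto)
    have "\<phi> t = integral {0..1-r} g" if "1 - r \<le> t" for t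
      unfolding \<phi>_def using Henstock_Kurzweil_Integration.integral_combine[of 0 "1-r" t g] int r that * by simp
    from this[of x] this[of 1] show ?thesis using that mean r unfolding \<phi>_def by simp
  qed
  show deriv: "(\<phi> has_real_derivative g x) (at x)" for x
  proof -
    consider "x < r" | "x > 1 - r" | "0 < x" "x < 1" using r by linarith
    then show ?thesis
    proof cases
      case 1
      have "((\<lambda>_. 0) has_real_derivative 0) (at x)" by simp
      then have "(\<phi> has_real_derivative 0) (at x)"
        by (rule has_field_derivative_transform_within_open[where S="{..<r}"]) (use 1 lo in auto)
      then show ?thesis using supp[of x] 1 by simp
    next
      case 2
      have "((\<lambda>_. 0) has_real_derivative 0) (at x)" by simp
      then have "(\<phi> has_real_derivative 0) (at x)"
        by (rule has_field_derivative_transform_within_open[where S="{1-r<..}"]) (use 2 hi in auto)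
      then show ?thesis using supp[of x] 2 by simp
    next
      case 3
      have "(\<phi> has_real_derivative g x) (at x within {0..1})"
        unfolding \<phi>_def using integral_has_real_derivative[OF gc] 3 by simp
      then show ?thesis using 3 by (simp add: at_within_Icc_at)
    qed
  qed
  have "{x. \<phi> x \<noteq> 0} \<subseteq> {r..1-r}"
    using lo hi by (auto, metis linear, metis linear)
  then have "closure {x. \<phi> x \<noteq> 0} \<subseteq> {r..1-r}"
    by (rule closure_minimal) simp
  moreover from this have "compact (closure {x. \<phi> x \<noteq> 0})"
    by (meson bounded_closed_interval bounded_subset closed_closure compact_eq_bounded_closed)
  moreover have "\<phi> C1_differentiable_on UNIV"
    unfolding C1_differentiable_on_def using deriv g
    by (auto simp: has_real_derivative_iff_has_vector_derivative intro!: exI[of _ g])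
  ultimately show "\<phi> \<in> test_functions {0<..<1}"
    unfolding test_functions_def using r by force
qed

text \<open>
  The lemma of du Bois-Reymond.  Integration by parts shows that \<open>U = u - P\<close>, with \<open>P\<close> the primitive of
  \<open>v\<close>, is orthogonal to every continuous function of mean zero with support inside \<open>(0,1)\<close>.  Testing with
  approximations of indicator functions of \<open>{0..t}\<close>, corrected by a multiple of one fixed bump to have
  mean zero, yields that all integrals of \<open>U - c\<close> over \<open>{0..t}\<close> vanish for a suitable constant \<open>c\<close>.
\<close>

lemma weak_derivative_imp_primitive:
  assumes uv: "has_weak_derivative u v {0<..<1}"
  obtains c where "AE x\<in>{0..1} in lebesgue. u x = c + integral {0..x} v"
proof -
  have u: "u absolutely_integrable_on {0..1}" and v: "v absolutely_integrable_on {0..1}"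
    using uv by (auto simp: has_weak_derivative_def absolutely_integrable_on_Icc_iff_Ioo)
  have LINT: "(LINT x:{0<..<1}|lebesgue. h x) = integral {0..1} h"
    if "h absolutely_integrable_on {0..1}" for h :: "real \<Rightarrow> real"
    using that set_lebesgue_integral_eq_integral(2)[of "{0<..<1}" h]
    by (simp add: absolutely_integrable_on_Icc_iff_Ioo integral_open_interval_real)
  have prod: "(\<lambda>x. h x * g x) absolutely_integrable_on {0..1}"
    if "h absolutely_integrable_on {0..1}" "continuous_on {0..1} g" for h g :: "real \<Rightarrow> real"
    using absolutely_integrable_bounded_measurable_product_real[of g "{0..1}" h] that
    by (simp add: mult.commute continuous_imp_measurable_on_sets_lebesgue compact_imp_bounded compact_continuous_image)
  have prodi: "(\<lambda>x. h x * g x) integrable_on {0..1}"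
    if "h absolutely_integrable_on {0..1}" "continuous_on {0..1} g" for h g :: "real \<Rightarrow> real"
    using prod[OF that] set_lebesgue_integral_eq_integral(1) by blast
  define P where "P = (\<lambda>x. integral {0..x} v)"
  have Pc: "continuous_on {0..1} P"
    unfolding P_def using v by (intro indefinite_integral_continuous_1) (auto simp: absolutely_integrable_on_def)
  define U where "U = (\<lambda>x. u x - P x)"
  have U: "U absolutely_integrable_on {0..1}"
    unfolding U_def by (intro set_integral_diff u absolutely_integrable_continuous_real Pc)
  have orth: "integral {0..1} (\<lambda>x. U x * g x) = 0"
    if g: "continuous_on UNIV g" "integral {0..1} g = 0"
      and r: "0 < r" "r < 1/2" "\<And>x. x \<notin> {r<..<1-r} \<Longrightarrow> g x = 0" for g r
  proof -
    define \<phi> where "\<phi> = (\<lambda>x. integral {0..x} g)"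
    have gc: "continuous_on {0..1} g" using g(1) continuous_on_subset by blast
    have \<phi>: "\<phi> \<in> test_functions {0<..<1}" "\<And>x. (\<phi> has_real_derivative g x) (at x)"
      unfolding \<phi>_def using continuous_imp_test_function[OF g(1) r g(2)] by blast+
    have \<phi>c: "continuous_on {0..1} \<phi>"
      by (rule DERIV_continuous_on[OF DERIV_subset[OF \<phi>(2) subset_UNIV]])
    have "deriv \<phi> = g" using \<phi>(2) DERIV_imp_deriv by blast
    then have "integral {0..1} (\<lambda>x. u x * g x) = - integral {0..1} (\<lambda>x. v x * \<phi> x)"
      using uv \<phi>(1) LINT[OF prod[OF u gc]] LINT[OF prod[OF v \<phi>c]]
      unfolding has_weak_derivative_def by metis
    also have "\<dots> = integral {0..1} (\<lambda>x. P x * g x)"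
      using integral_by_parts_absolutely_integrable[OF _ v gc DERIV_subset[OF \<phi>(2)]] g(2)
      by (simp add: P_def \<phi>_def)
    finally have "integral {0..1} (\<lambda>x. u x * g x - P x * g x) = 0"
      using prodi[OF u gc] Pc gc
      by (subst Henstock_Kurzweil_Integration.integral_diff)
         (auto intro!: integrable_continuous_real continuous_intros)
    then show ?thesis by (simp add: U_def algebra_simps)
  qed
  \<comment> \<open>A trapezoid of height 1: the slopes \<open>n\<close> make it vanish within
    \<open>1/n\<close> of 0 and 1, and it tends to the indicator of \<open>{..t}\<close> on
    \<open>{0<..<1}\<close>.\<close>
  define k where "k = (\<lambda>t n x. max 0 (min 1 (min (real n * x - 1) (min (real n * (t - x) + 1) (real n * (1 - x) - 1)))))"
  have kc: "continuous_on S (k t n)" for S t n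
    unfolding k_def by (intro continuous_intros)
  have k_range: "0 \<le> k t n x \<and> k t n x \<le> 1" for t n x
    unfolding k_def by (simp add: max.coboundedI1)
  have k_supp: "k t n x = 0" if "n \<ge> 1" "x \<notin> {1 / real n<..<1 - 1 / real n}" for t n x
  proof -
    have "real n * x - 1 \<le> 0 \<or> real n * (1 - x) - 1 \<le> 0"
      using that by (auto simp: field_simps)
    then show ?thesis unfolding k_def by (auto simp: max_def min_def)
  qed
  have k_lim: "(\<lambda>n. k t n x) \<longlonglongrightarrow> indicator {..t} x" if x: "0 < x" "x < 1" for t x
  proof -
    have arch: "\<forall>\<^sub>F n in sequentially. real n * d \<ge> 2" if "d > 0" for d :: real
    proof -
      obtain N where N: "real N \<ge> 2 / d" using real_arch_simple by blast
      show ?thesis using eventually_ge_at_top[of N]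
        by eventually_elim (use N that in \<open>auto simp: field_simps intro: order_trans[of _ "real N * d"]\<close>)
    qed
    have "\<forall>\<^sub>F n in sequentially. k t n x = indicator {..t} x"
    proof (cases "x \<le> t")
      case True
      have "1 - x > 0" using x(2) by simp
      from arch[OF x(1)] arch[OF this] show ?thesis
      proof eventually_elim
        case (elim n)
        have "real n * (t - x) \<ge> 0" using True by simp
        with elim True show ?case by (simp add: k_def)
      qed
    next
      case False
      then have "x - t > 0" by simp
      from arch[OF this] show ?thesis
      proof eventually_elim
        case (elim n)
        then have "real n * (t - x) + 1 \<le> 0" by (simp add: algebra_simps)
        with False show ?case by (simp add: k_def)
      qed
    qed
    then show ?thesis by (rule tendsto_eventually)
  qed
  have k_int: "(\<lambda>n. integral {0..1} (\<lambda>x. h x * k t n x)) \<longlonglongrightarrow> integral {0..t} h"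
    if h: "h absolutely_integrable_on {0..1}" and t: "0 \<le> t" "t \<le> 1" for h t
  proof -
    have "(\<lambda>n. integral {0<..<1} (\<lambda>x. h x * k t n x)) \<longlonglongrightarrow> integral {0<..<1} (\<lambda>x. h x * indicator {..t} x)"
    proof (rule dominated_convergence)
      show "(\<lambda>x. h x * k t n x) integrable_on {0<..<1}" for n
        using prodi[OF h kc] by (simp add: integrable_on_Icc_iff_Ioo)
      show "(\<lambda>x. \<bar>h x\<bar>) integrable_on {0<..<1}"
        using h by (auto simp: absolutely_integrable_on_def integrable_on_Icc_iff_Ioo)
      show "norm (h x * k t n x) \<le> \<bar>h x\<bar>" for n x
        using k_range[of t n x] by (simp add: abs_mult mult_left_le)
      show "(\<lambda>n. h x * k t n x) \<longlonglongrightarrow> h x * indicator {..t} x" if "x \<in> {0<..<1}" for x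
        using that by (intro tendsto_intros k_lim) auto
    qed
    also have "integral {0<..<1} (\<lambda>x. h x * indicator {..t} x) = integral {0..1} (\<lambda>x. h x * indicator {..t} x)"
      by (simp add: integral_open_interval_real)
    also have "\<dots> = integral {0..1} (\<lambda>x. if x \<in> {0..t} then h x else 0)"
      by (rule Henstock_Kurzweil_Integration.integral_cong) (auto simp: indicator_def)
    also have "\<dots> = integral {0..t} h"
      using t by (simp only: integral_restrict_Int) (simp add: min_absorb2)
    finally show ?thesis by (simp add: integral_open_interval_real)
  qed
  have one: "(\<lambda>x::real. 1::real) absolutely_integrable_on {0..1}"
    by (rule absolutely_integrable_continuous_real) (rule continuous_on_const)
  have kint1: "(\<lambda>n. integral {0..1} (k t n)) \<longlonglongrightarrow> t" if "0 \<le> t" "t \<le> 1" for t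
    using k_int[OF one that] that by simp
  have "\<forall>\<^sub>F n in sequentially. integral {0..1} (k 1 n) > 0 \<and> n \<ge> 3"
    using order_tendstoD(1)[OF kint1[of 1], of 0] by (intro eventually_conj eventually_ge_at_top) simp
  then obtain N where N: "integral {0..1} (k 1 N) > 0" "N \<ge> 3"
    using eventually_happens'[OF sequentially_bot] by blast
  \<comment> \<open>The trapezoid \<open>k 1 N\<close> serves as the fixed bump; \<open>n \<ge>
    3\<close> and \<open>N \<ge> 3\<close> keep the margins \<open>1/n\<close> and \<open>1/N\<close>
    below \<open>1/2\<close>.\<close>
  define m where "m = integral {0..1} (k 1 N)"
  define c where "c = integral {0..1} (\<lambda>x. U x * k 1 N x) / m"
  have m: "m > 0" using N by (simp add: m_def)
  have "integral {0..t} (\<lambda>x. U x - c) = 0" if t: "0 \<le> t" "t \<le> 1" for t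
  proof -
    have "integral {0..1} (\<lambda>x. U x * k t n x) = integral {0..1} (k t n) * c" if n: "n \<ge> 3" for n
    proof -
      define \<beta> where "\<beta> = integral {0..1} (k t n) / m"
      define g where "g = (\<lambda>x. k t n x - \<beta> * k 1 N x)"
      have "integral {0..1} (\<lambda>x. U x * g x) = 0"
      proof (rule orth)
        show "continuous_on UNIV g" unfolding g_def by (intro continuous_intros kc)
        have "integral {0..1} g = integral {0..1} (k t n) - \<beta> * m"
          unfolding g_def m_def
          by (subst Henstock_Kurzweil_Integration.integral_diff)
             (auto intro!: integrable_continuous_real continuous_intros kc)
        then show "integral {0..1} g = 0" using m by (simp add: \<beta>_def)
        let ?r = "min (1 / real n) (1 / real N)"
        have "1 / real n < 1 / 2" using n by (simp add: field_simps)
        then show "?r < 1/2" by linarith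
        show "0 < ?r" using n N by simp
        show "g x = 0" if "x \<notin> {?r<..<1 - ?r}" for x
        proof -
          have "k t n x = 0" by (rule k_supp) (use that n in auto)
          moreover have "k 1 N x = 0" by (rule k_supp) (use that N in auto)
          ultimately show ?thesis by (simp add: g_def)
        qed
      qed
      also have "integral {0..1} (\<lambda>x. U x * g x)
        = integral {0..1} (\<lambda>x. U x * k t n x - \<beta> * (U x * k 1 N x))"
        by (rule Henstock_Kurzweil_Integration.integral_cong) (simp add: g_def algebra_simps)
      also have "\<dots> = integral {0..1} (\<lambda>x. U x * k t n x) - \<beta> * integral {0..1} (\<lambda>x. U x * k 1 N x)"
        using Henstock_Kurzweil_Integration.integral_diff[OF prodi[OF U kc[of _ t n]]
            integrable_on_mult_right[OF prodi[OF U kc[of _ 1 N]], of \<beta>]]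
        by simp
      finally show ?thesis by (simp add: c_def \<beta>_def)
    qed
    then have "\<forall>\<^sub>F n in sequentially. integral {0..1} (\<lambda>x. U x * k t n x) = integral {0..1} (k t n) * c"
      by (intro eventually_mono[OF eventually_ge_at_top[of 3]])
    with k_int[OF U t] have "(\<lambda>n. integral {0..1} (k t n) * c) \<longlonglongrightarrow> integral {0..t} U"
      by (rule Lim_transform_eventually)
    moreover have "(\<lambda>n. integral {0..1} (k t n) * c) \<longlonglongrightarrow> t * c"
      by (intro tendsto_intros kint1 t)
    ultimately have "integral {0..t} U = t * c" using LIMSEQ_unique by blast
    moreover have "U integrable_on {0..t}"
      using U t integrable_on_subinterval[of U "{0..1}" 0 t] by (auto simp: absolutely_integrable_on_def)
    ultimately show ?thesis
      using t by (subst Henstock_Kurzweil_Integration.integral_diff) auto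
  qed
  moreover have "(\<lambda>x. U x - c) absolutely_integrable_on {0..1}"
    by (intro set_integral_diff U absolutely_integrable_continuous_real continuous_intros)
  ultimately have "AE x\<in>{0..1} in lebesgue. U x - c = 0"
    by (intro interval_integrals_zero_imp_AE_zero) auto
  then have "AE x\<in>{0..1} in lebesgue. u x = c + integral {0..x} v"
    by eventually_elim (auto simp: U_def P_def)
  with that show thesis by blast
qed

section \<open>Regular solutions are continuously differentiable\<close>

text \<open>
  The sine of the angle whose tangent is the slope \<open>s\<close>; its derivative along a graph is the curvature.
\<close>

definition curvature_flux :: "real \<Rightarrow> real" where
  "curvature_flux s = s / sqrt (1 + s\<^sup>2)"

lemma one_plus_square_pos: "0 < 1 + (s::real)\<^sup>2"
  by (simp add: add_pos_nonneg)

lemma one_plus_square_neq_0: "1 + (s::real)\<^sup>2 \<noteq> 0"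
  using one_plus_square_pos[of s] by linarith

lemma strict_mono_curvature_flux: "strict_mono curvature_flux"
proof (rule strict_monoI)
  fix s t :: real assume "s < t"
  have deriv: "(curvature_flux has_real_derivative 1 / (sqrt (1 + x\<^sup>2)) ^ 3) (at x)" for x
  proof -
    have sq: "sqrt (1 + x\<^sup>2) > 0" "(sqrt (1 + x\<^sup>2))\<^sup>2 = 1 + x\<^sup>2"
      using one_plus_square_pos[of x] by auto
    have "((\<lambda>s. s / sqrt (1 + s\<^sup>2)) has_real_derivative
        (1 * sqrt (1 + x\<^sup>2) - x * (2 * x * (inverse (sqrt (1 + x\<^sup>2)) / 2))) / (sqrt (1 + x\<^sup>2) * sqrt (1 + x\<^sup>2))) (at x)"
      using sq(1) one_plus_square_pos[of x]
      by (auto intro!: derivative_eq_intros)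
    also have "(1 * sqrt (1 + x\<^sup>2) - x * (2 * x * (inverse (sqrt (1 + x\<^sup>2)) / 2))) / (sqrt (1 + x\<^sup>2) * sqrt (1 + x\<^sup>2))
      = 1 / (sqrt (1 + x\<^sup>2)) ^ 3"
      using sq by (simp add: field_simps power2_eq_square power3_eq_cube)
    finally show ?thesis unfolding curvature_flux_def .
  qed
  show "curvature_flux s < curvature_flux t"
    by (rule DERIV_pos_imp_increasing[OF \<open>s < t\<close>])
       (use deriv one_plus_square_pos in \<open>fastforce intro!: zero_less_divide_iff[THEN iffD2]\<close>)
qed

lemma curvature_flux_gt_minus_1: "- 1 < curvature_flux s"
proof -
  have "\<bar>s\<bar> = sqrt (s\<^sup>2)" by simp
  also have "\<dots> < sqrt (1 + s\<^sup>2)" by (simp only: real_sqrt_less_iff)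
  finally show ?thesis
    using one_plus_square_pos[of s] unfolding curvature_flux_def by (simp add: field_simps)
qed

lemma curvature_flux_0 [simp]: "curvature_flux 0 = 0"
  by (simp add: curvature_flux_def)

lemma continuous_on_curvature_flux: "continuous_on S curvature_flux"
  unfolding curvature_flux_def
  by (intro continuous_intros) (simp add: one_plus_square_neq_0)

lemma absolutely_integrable_L_infinity:
  assumes "a \<in> L_infinity {0<..<1}"
  shows "a absolutely_integrable_on {0..1}"
proof -
  obtain C where C: "AE x\<in>{0<..<1} in lebesgue. \<bar>a x\<bar> \<le> C"
    and m: "a \<in> borel_measurable (lebesgue_on {0<..<1})"
    using assms by (auto simp: L_infinity_def)
  have "set_integrable lebesgue {0<..<1} a"
    unfolding set_integrable_def
  proof (rule integrableI_bounded_set[where A = "{0<..<1}" and B = C])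
    show "(\<lambda>x. indicator {0<..<1} x *\<^sub>R a x) \<in> borel_measurable lebesgue"
      using m by (simp add: borel_measurable_restrict_space_iff mult.commute)
    show "AE x in lebesgue. x \<in> {0<..<1} \<longrightarrow> norm (indicator {0<..<1} x *\<^sub>R a x) \<le> C"
      using C by eventually_elim auto
  qed auto
  then show ?thesis by (simp add: absolutely_integrable_on_Icc_iff_Ioo)
qed

text \<open>
  The representative \<open>V\<close> is the primitive of the weak derivative of \<open>u'\<close>, plus a constant; the flux
  equation holds with it at every point because both sides are continuous.
\<close>

lemma regular_solution_is_C1:
  assumes sol: "regular_solution a f lam u"
  obtains V where "continuous_on {0..1} V"
    and "\<And>x. x \<in> {0..1} \<Longrightarrow> (u has_real_derivative V x) (at x within {0..1})"
    and "V 0 = 0" and "V 1 = 0"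
    and "\<And>x y. \<lbrakk>0 \<le> x; x \<le> y; y \<le> 1\<rbrakk> \<Longrightarrow>
      curvature_flux (V y) - curvature_flux (V x) = - lam * integral {x..y} (\<lambda>t. a t * f (u t))"
proof -
  define \<psi> where "\<psi> = curvature_flux"
  have prim_cont: "continuous_on {0..1} (\<lambda>x. c + integral {0..x} v)"
    if "has_weak_derivative r v {0<..<1}" for r v :: "real \<Rightarrow> real" and c
    using that unfolding has_weak_derivative_def absolutely_integrable_on_Icc_iff_Ioo[symmetric]
    by (intro continuous_intros indefinite_integral_continuous_1) (auto simp: absolutely_integrable_on_def)
  have ai: "v absolutely_integrable_on {0..1}"
    if "has_weak_derivative r v {0<..<1}" for r v :: "real \<Rightarrow> real"
    using that unfolding has_weak_derivative_def absolutely_integrable_on_Icc_iff_Ioo[symmetric] by blast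
  obtain v w where u: "continuous_on {0..1} u"
    and uv: "has_weak_derivative u v {0<..<1}"
    and vw: "has_weak_derivative (\<lambda>x. \<psi> (v x)) w {0<..<1}"
    and w: "AE x\<in>{0<..<1} in lebesgue. - w x = lam * a x * f (u x)"
    and u0: "(u has_real_derivative 0) (at 0 within {0..1})"
    and u1: "(u has_real_derivative 0) (at 1 within {0..1})"
    using sol unfolding regular_solution_def \<psi>_def curvature_flux_def by blast
  \<comment> \<open>The second weak derivative is attached to some first weak derivative
    \<open>v1\<close>, which has to be identified with \<open>v\<close>.\<close>
  obtain v1 v1' where uv1: "has_weak_derivative u v1 {0<..<1}"
    and v1: "has_weak_derivative v1 v1' {0<..<1}"
    using sol unfolding regular_solution_def W21_def W11_def by blast
  obtain c0 where c0: "AE x\<in>{0..1} in lebesgue. u x = c0 + integral {0..x} v"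
    using weak_derivative_imp_primitive[OF uv] .
  obtain c1 where c1: "AE x\<in>{0..1} in lebesgue. u x = c1 + integral {0..x} v1"
    using weak_derivative_imp_primitive[OF uv1] .
  obtain c2 where c2: "AE x\<in>{0..1} in lebesgue. v1 x = c2 + integral {0..x} v1'"
    using weak_derivative_imp_primitive[OF v1] .
  obtain c3 where c3: "AE x\<in>{0..1} in lebesgue. \<psi> (v x) = c3 + integral {0..x} w"
    using weak_derivative_imp_primitive[OF vw] .
  define V where "V = (\<lambda>x. c2 + integral {0..x} v1')"
  have Vc: "continuous_on {0..1} V" unfolding V_def by (rule prim_cont[OF v1])
  have u_c0: "u x = c0 + integral {0..x} v" if "x \<in> {0..1}" for x
    by (rule continuous_eq_if_AE_eq[OF u prim_cont[OF uv] _ c0 that]) simp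
  have u_c1: "u x = c1 + integral {0..x} v1" if "x \<in> {0..1}" for x
    by (rule continuous_eq_if_AE_eq[OF u prim_cont[OF uv1] _ c1 that]) simp
  have "AE x\<in>{0..1} in lebesgue. v x - v1 x = 0"
  proof (rule interval_integrals_zero_imp_AE_zero)
    show "(\<lambda>x. v x - v1 x) absolutely_integrable_on {0..1}"
      by (intro set_integral_diff ai[OF uv] ai[OF uv1])
    show "integral {0..t} (\<lambda>x. v x - v1 x) = 0" if t: "0 \<le> t" "t \<le> 1" for t
    proof -
      have "v integrable_on {0..t}" "v1 integrable_on {0..t}"
        using ai[OF uv] ai[OF uv1] t integrable_on_subinterval[of _ "{0..1}" 0 t]
        by (auto simp: absolutely_integrable_on_def)
      then show ?thesis
        using u_c0[of t] u_c1[of t] u_c0[of 0] u_c1[of 0] t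
        by (simp add: Henstock_Kurzweil_Integration.integral_diff)
    qed
  qed
  with c2 have vV: "AE x\<in>{0..1} in lebesgue. v x = V x"
    by eventually_elim (auto simp: V_def)
  have uV: "u x = c0 + integral {0..x} V" if "x \<in> {0..1}" for x
    using u_c0[OF that] integral_eq_if_AE_eq[OF vV, of "{0..x}"] that by auto
  have deriv: "(u has_real_derivative V x) (at x within {0..1})" if "x \<in> {0..1}" for x
  proof -
    have "((\<lambda>x. c0 + integral {0..x} V) has_real_derivative V x) (at x within {0..1})"
      using DERIV_add[OF DERIV_const integral_has_real_derivative[OF Vc that]] by simp
    then show ?thesis
      by (rule has_field_derivative_transform_within[OF _ zero_less_one that]) (simp add: uV)
  qed
  have uniq: "V x = 0" if "(u has_real_derivative 0) (at x within {0..1})" "x \<in> {0..1}" for x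
    using vector_derivative_unique_within_closed_interval[of 0 1 x u "V x" 0] deriv[OF that(2)] that
    by (simp add: has_real_derivative_iff_has_vector_derivative)
  have \<psi>c: "continuous_on S \<psi>" for S
    unfolding \<psi>_def by (rule continuous_on_curvature_flux)
  have \<psi>V: "\<psi> (V x) = c3 + integral {0..x} w" if "x \<in> {0..1}" for x
  proof (rule continuous_eq_if_AE_eq[OF _ prim_cont[OF vw] _ _ that])
    show "continuous_on {0..1} (\<lambda>x. \<psi> (V x))"
      by (rule continuous_on_compose2[OF \<psi>c[of UNIV] Vc]) auto
    show "AE x\<in>{0..1} in lebesgue. \<psi> (V x) = c3 + integral {0..x} w"
      using c3 vV by eventually_elim auto
  qed simp
  have "\<psi> (V y) - \<psi> (V x) = - lam * integral {x..y} (\<lambda>t. a t * f (u t))"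
    if xy: "0 \<le> x" "x \<le> y" "y \<le> 1" for x y
  proof -
    have "w integrable_on {0..y}"
      using ai[OF vw] xy integrable_on_subinterval[of w "{0..1}" 0 y]
      by (auto simp: absolutely_integrable_on_def)
    then have "\<psi> (V y) - \<psi> (V x) = integral {x..y} w"
      using \<psi>V[of x] \<psi>V[of y] xy Henstock_Kurzweil_Integration.integral_combine[of 0 x y w] by simp
    also have "\<dots> = integral {x..y} (\<lambda>t. - lam * (a t * f (u t)))"
    proof (rule integral_eq_if_AE_eq)
      show "AE t\<in>{0..1} in lebesgue. w t = - lam * (a t * f (u t))"
        using AE_on_Icc_if_Ioo[OF w] by eventually_elim (auto simp: algebra_simps)
    qed (use xy in auto)
    also have "\<dots> = - lam * integral {x..y} (\<lambda>t. a t * f (u t))"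
      by (rule integral_mult_right)
    finally show ?thesis .
  qed
  then show thesis
    using that[of V] Vc deriv uniq[OF u0] uniq[OF u1] by (simp add: \<psi>_def)
qed

section \<open>Energy estimate\<close>

text \<open>
  With \<open>\<psi> = curvature_flux \<circ> V\<close> one has \<open>\<psi>\<^sup>2 + E\<^sup>2 = 1\<close>, so increments of \<open>E\<close> are \<open>R\<close> times increments of
  \<open>\<psi>\<close> with \<open>R = - (\<psi>(x) + \<psi>(y)) / (E(x) + E(y)) \<ge> 0\<close>, and \<open>R\<close> tends to \<open>- V(x)\<close> as \<open>y\<close> decreases to \<open>x\<close>.
  Thus \<open>s E + k F \<circ> u\<close> has lower right difference quotients at least \<open>k f(u) (- V) + k f(u) V = 0\<close>.  The
  sign \<open>s\<close> covers the case of a decreasing flux (\<open>s = -1\<close>, where \<open>a > 0\<close>) and that of an increasing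
  one (\<open>s = 1\<close>, where \<open>a < 0\<close>).
\<close>

lemma energy_inequality:
  fixes u V f F :: "real \<Rightarrow> real" and s k :: real
  defines "E \<equiv> (\<lambda>x. 1 / sqrt (1 + (V x)\<^sup>2))"
  assumes ab: "a \<le> b" and V: "continuous_on {a..b} V" "\<And>x. x \<in> {a..b} \<Longrightarrow> V x \<le> 0"
    and u: "\<And>x. x \<in> {a..b} \<Longrightarrow> (u has_real_derivative V x) (at x within {a..b})"
    and u_nonneg: "\<And>x. x \<in> {a..b} \<Longrightarrow> 0 \<le> u x"
    and f: "continuous_on UNIV f"
    and F: "\<And>r. 0 \<le> r \<Longrightarrow> (F has_real_derivative f r) (at r within {0..})"
    and incr: "\<And>x y. \<lbrakk>a \<le> x; x \<le> y; y \<le> b\<rbrakk> \<Longrightarrow>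
      k * integral {x..y} (\<lambda>t. f (u t)) \<le> s * (curvature_flux (V y) - curvature_flux (V x))"
  shows "k * (F (u a) - F (u b)) \<le> s * (E b - E a)"
proof -
  define \<psi> where "\<psi> = (\<lambda>x. curvature_flux (V x))"
  have E_pos: "E x > 0" for x
    using one_plus_square_pos by (simp add: E_def)
  have \<psi>E: "\<psi> x = V x * E x" for x
    by (simp add: \<psi>_def curvature_flux_def E_def)
  have unit: "(\<psi> x)\<^sup>2 + (E x)\<^sup>2 = 1" for x
  proof -
    have E2: "(E x)\<^sup>2 = inverse (1 + (V x)\<^sup>2)"
      using one_plus_square_pos[of "V x"] by (simp add: E_def power_divide inverse_eq_divide)
    have "(\<psi> x)\<^sup>2 + (E x)\<^sup>2 = (1 + (V x)\<^sup>2) * (E x)\<^sup>2"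
      by (simp add: \<psi>E power_mult_distrib distrib_right)
    then show ?thesis by (simp only: E2 right_inverse[OF one_plus_square_neq_0])
  qed
  have Ec: "continuous_on {a..b} E"
    unfolding E_def by (intro continuous_intros V(1)) (simp add: one_plus_square_neq_0)
  have \<psi>c: "continuous_on {a..b} \<psi>"
    unfolding \<psi>_def by (rule continuous_on_compose2[OF continuous_on_curvature_flux[of UNIV] V(1)]) auto
  have uc: "continuous_on {a..b} u" by (rule DERIV_continuous_on[OF u])
  have fuc: "continuous_on {a..b} (\<lambda>x. f (u x))"
    by (rule continuous_on_compose2[OF f uc]) auto
  have Fu: "((\<lambda>x. F (u x)) has_real_derivative f (u x) * V x) (at x within {a..b})" if "x \<in> {a..b}" for x
  proof -
    have "(F has_real_derivative f (u x)) (at (u x) within u ` {a..b})"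
      by (rule DERIV_subset[OF F]) (use that u_nonneg in auto)
    from DERIV_image_chain[OF this u[OF that]] show ?thesis by (simp add: o_def)
  qed
  define H where "H = (\<lambda>x. - s * E x - k * F (u x))"
  have Hc: "continuous_on {a..b} H"
    unfolding H_def by (intro continuous_intros Ec DERIV_continuous_on[OF Fu])
  have "H b \<le> H a"
  proof (rule nonincreasing_if_right_difference_quotients[OF ab Hc])
    fix x e :: real assume x: "a \<le> x" "x < b" and e: "e > 0"
    have sub: "{x..b} \<subseteq> {a..b}" and xin: "x \<in> {a..b}" using x by auto
    have right: "at x within {x..b} = at_right x" using x by (simp add: at_within_Icc_at_right)
    \<comment> \<open>The difference quotient of \<open>E\<close> with respect to
      \<open>\<psi>\<close>.\<close>
    define R where "R = (\<lambda>y. - (\<psi> x + \<psi> y) / (E x + E y))"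
    have to_right: "(h \<longlongrightarrow> h x) (at_right x)" if "continuous_on {a..b} h" for h :: "real \<Rightarrow> real"
      using continuous_on_subset[OF that sub] x unfolding right[symmetric] continuous_on_def by auto
    have "(R \<longlongrightarrow> R x) (at_right x)"
      unfolding R_def using E_pos[of x] by (intro tendsto_intros to_right \<psi>c Ec) auto
    moreover have "R x = - V x"
    proof -
      have "E x + E x \<noteq> 0" using E_pos[of x] by linarith
      moreover have "- (\<psi> x + \<psi> x) = - V x * (E x + E x)"
        unfolding \<psi>E by (simp only: distrib_left minus_add_distrib mult_minus_left)
      ultimately show ?thesis unfolding R_def by (metis nonzero_mult_div_cancel_right)
    qed
    ultimately have R_lim: "(R \<longlongrightarrow> - V x) (at_right x)" by simp
    have I_lim: "((\<lambda>y. integral {x..y} (\<lambda>t. f (u t)) / (y - x)) \<longlongrightarrow> f (u x)) (at_right x)"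
      using integral_has_real_derivative[OF continuous_on_subset[OF fuc sub], of x] x
      by (simp add: has_field_derivative_iff right)
    have F_lim: "((\<lambda>y. (F (u y) - F (u x)) / (y - x)) \<longlongrightarrow> f (u x) * V x) (at_right x)"
      using DERIV_subset[OF Fu[OF xin] sub] by (simp add: has_field_derivative_iff right)
    have "((\<lambda>y. - k * (R y * (integral {x..y} (\<lambda>t. f (u t)) / (y - x)) + (F (u y) - F (u x)) / (y - x)))
        \<longlongrightarrow> - k * (- V x * f (u x) + f (u x) * V x)) (at_right x)"
      by (intro tendsto_intros R_lim I_lim F_lim)
    then have "\<forall>\<^sub>F y in at_right x.
        - k * (R y * (integral {x..y} (\<lambda>t. f (u t)) / (y - x)) + (F (u y) - F (u x)) / (y - x)) < e"
      by (rule order_tendstoD(2)) (use e in simp)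
    moreover have "\<forall>\<^sub>F y in at_right x. x < y \<and> y < b"
      using x(2) by (auto simp: eventually_conj_iff eventually_at_right_less eventually_at_right[OF x(2)])
    ultimately show "\<forall>\<^sub>F y in at_right x. H y - H x \<le> e * (y - x)"
    proof eventually_elim
      case (elim y)
      let ?I = "integral {x..y} (\<lambda>t. f (u t))"
      have "(E y - E x) * (E x + E y) = - (\<psi> y - \<psi> x) * (\<psi> x + \<psi> y)"
        using unit[of x] unit[of y] by (simp add: algebra_simps power2_eq_square)
      moreover have "E x + E y \<noteq> 0" using E_pos[of x] E_pos[of y] by linarith
      ultimately have "E y - E x = - (\<psi> y - \<psi> x) * (\<psi> x + \<psi> y) / (E x + E y)"
        by (metis nonzero_eq_divide_eq)
      then have diff: "E y - E x = R y * (\<psi> y - \<psi> x)"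
        by (simp add: R_def) (simp add: algebra_simps)
      have "\<psi> x \<le> 0" "\<psi> y \<le> 0"
        unfolding \<psi>E using x elim
        by (auto intro!: mult_nonpos_nonneg V(2) less_imp_le[OF E_pos])
      then have R_nonneg: "R y \<ge> 0"
        using E_pos[of x] E_pos[of y] by (simp add: R_def divide_nonneg_pos)
      have "R y * (k * ?I) \<le> R y * (s * (\<psi> y - \<psi> x))"
        unfolding \<psi>_def using x elim by (intro mult_left_mono[OF incr R_nonneg]) auto
      then have "k * R y * ?I \<le> s * (E y - E x)" unfolding diff by (simp add: mult_ac)
      then have "H y - H x \<le> - k * (R y * ?I + (F (u y) - F (u x)))"
        by (simp add: H_def algebra_simps)
      also have "\<dots> = (- k * (R y * (?I / (y - x)) + (F (u y) - F (u x)) / (y - x))) * (y - x)"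
      proof -
        have "R y * (?I / (y - x)) + (F (u y) - F (u x)) / (y - x) = (R y * ?I + (F (u y) - F (u x))) / (y - x)"
          by (simp only: add_divide_distrib times_divide_eq_right)
        moreover have "y - x \<noteq> 0" using elim by simp
        ultimately show ?thesis by simp
      qed
      also have "\<dots> \<le> e * (y - x)"
        using elim by (intro mult_right_mono) auto
      finally show ?case .
    qed
  qed
  then show ?thesis by (simp add: H_def algebra_simps)
qed

lemma integral_has_derivative_on_halfline:
  fixes f :: "real \<Rightarrow> real"
  assumes f: "continuous_on UNIV f" and r: "0 \<le> r"
  shows "((\<lambda>r. integral {0..r} f) has_real_derivative f r) (at r within {0..})"
proof -
  have "((\<lambda>r. integral {0..r} f) has_real_derivative f r) (at r within {0..r + 1})"
    using r by (intro integral_has_real_derivative continuous_on_subset[OF f]) auto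
  moreover have "at r within {0..r + 1} = at r within {0..}"
    by (rule at_within_nhd[of _ "{..<r + 1}"]) auto
  ultimately show ?thesis by simp
qed

lemma integral_at_top_if_slow_power_decay:
  fixes f :: "real \<Rightarrow> real"
  assumes f: "continuous_on UNIV f" "\<And>r. r \<ge> 0 \<Longrightarrow> f r \<ge> 0"
    and hq: "h > 0" "0 < q" "q < 1"
    and lim: "((\<lambda>u. f u / u powr (- q)) \<longlongrightarrow> h) at_top"
  shows "filterlim (\<lambda>r. integral {0..r} f) at_top at_top"
proof (rule filterlim_at_top_mono)
  show "filterlim (\<lambda>r. h / 4 * r powr (1 - q)) at_top at_top"
    using hq by real_asymp
  have int: "f integrable_on {x..y}" for x y
    by (rule integrable_continuous_real[OF continuous_on_subset[OF f(1)]]) simp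
  have "\<forall>\<^sub>F s in at_top. f s / s powr (- q) > h / 2"
    using lim hq by (intro order_tendstoD(1)) auto
  then obtain T where T: "\<And>s. s \<ge> T \<Longrightarrow> f s / s powr (- q) > h / 2"
    by (auto simp: eventually_at_top_linorder)
  show "\<forall>\<^sub>F r in at_top. h / 4 * r powr (1 - q) \<le> integral {0..r} f"
    using eventually_ge_at_top[of "max 1 (2 * T)"]
  proof eventually_elim
    case (elim r)
    have "h / 2 * r powr (- q) \<le> f s" if s: "s \<in> {r / 2..r}" for s
    proof -
      have "s > 0" "s \<ge> T" using s elim by auto
      have "h / 2 * r powr (- q) \<le> h / 2 * s powr (- q)"
        using s \<open>s > 0\<close> hq by (intro mult_left_mono powr_mono2') auto
      also have "\<dots> \<le> f s" using T[OF \<open>s \<ge> T\<close>] \<open>s > 0\<close> by (simp add: pos_less_divide_eq)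
      finally show ?thesis .
    qed
    then have lower: "integral {r / 2..r} (\<lambda>_. h / 2 * r powr (- q)) \<le> integral {r / 2..r} f"
      by (intro integral_le int) auto
    have const: "integral {r / 2..r} (\<lambda>_. h / 2 * r powr (- q)) = h / 4 * r powr (1 - q)"
    proof -
      have "r * r powr (- q) = r powr (1 - q)"
        using powr_mult_base[of r "- q"] elim by simp
      then show ?thesis using elim by simp
    qed
    have split: "integral {0..r} f = integral {0..r / 2} f + integral {r / 2..r} f"
      using elim by (intro Henstock_Kurzweil_Integration.integral_combine[symmetric] int) auto
    have rest: "0 \<le> integral {0..r / 2} f"
      by (rule integral_nonneg[OF int]) (use f in auto)
    show ?case
      unfolding split const[symmetric] by (rule add_increasing[OF rest lower])
  qed
qed

section \<open>Solutions bounded away from zero\<close>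

text \<open>
  The slope falls from \<open>V 0 = 0\<close> up to \<open>z\<close> and rises to \<open>V 1 = 0\<close> afterwards, so it is never positive.  The
  last claim says that on \<open>{0..z}\<close> the graph of the concave function \<open>u\<close> lies above the chord from
  \<open>(0, u 0)\<close> to \<open>(z, 0)\<close>.
\<close>

lemma slopes_of_positive_solution:
  fixes u V :: "real \<Rightarrow> real"
  assumes z: "0 < z" "z < 1" and V0: "V 0 = 0" and V1: "V 1 = 0"
    and u: "\<And>x. x \<in> {0..1} \<Longrightarrow> (u has_real_derivative V x) (at x within {0..1})"
    and u_nonneg: "\<And>x. x \<in> {0..1} \<Longrightarrow> 0 \<le> u x"
    and left: "\<And>x y. \<lbrakk>0 \<le> x; x \<le> y; y \<le> z\<rbrakk> \<Longrightarrow> V y \<le> V x"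
    and right: "\<And>x y. \<lbrakk>z \<le> x; x \<le> y; y \<le> 1\<rbrakk> \<Longrightarrow> V x \<le> V y"
  shows "\<And>x. x \<in> {0..1} \<Longrightarrow> V x \<le> 0"
    and "\<And>x y. \<lbrakk>0 \<le> x; x \<le> y; y \<le> 1\<rbrakk> \<Longrightarrow> u y \<le> u x"
    and "\<And>t. \<lbrakk>0 \<le> t; t \<le> z\<rbrakk> \<Longrightarrow> (1 - t / z) * u 0 \<le> u t"
proof -
  show V: "V x \<le> 0" if "x \<in> {0..1}" for x
    using left[of 0 x] right[of x 1] that z V0 V1 by (cases "x \<le> z") auto
  have mvt: "\<exists>\<xi>. x \<le> \<xi> \<and> \<xi> \<le> y \<and> u y - u x = (y - x) * V \<xi>" if "0 \<le> x" "x \<le> y" "y \<le> 1" for x y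
  proof (cases "x = y")
    case False
    then have "x < y" using that by simp
    have "\<exists>\<xi>\<in>{x<..<y}. u y - u x = V \<xi> * (y - x)"
    proof (rule mvt_simple[OF \<open>x < y\<close>])
      fix \<xi> assume "x \<le> \<xi>" "\<xi> \<le> y"
      then have "(u has_real_derivative V \<xi>) (at \<xi> within {x..y})"
        by (intro DERIV_subset[OF u]) (use that in auto)
      then show "(u has_derivative (\<lambda>h. V \<xi> * h)) (at \<xi> within {x..y})"
        by (simp add: has_field_derivative_def)
    qed
    then obtain \<xi> where "x < \<xi>" "\<xi> < y" "u y - u x = (y - x) * V \<xi>"
      by (auto simp: mult.commute)
    then show ?thesis by (intro exI[of _ \<xi>]) simp
  qed auto
  show "u y \<le> u x" if xy: "0 \<le> x" "x \<le> y" "y \<le> 1" for x y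
  proof -
    obtain \<xi> where "x \<le> \<xi>" "\<xi> \<le> y" "u y - u x = (y - x) * V \<xi>" using mvt[OF xy] by blast
    moreover have "(y - x) * V \<xi> \<le> 0"
      using V[of \<xi>] \<open>x \<le> \<xi>\<close> \<open>\<xi> \<le> y\<close> xy by (auto simp: mult_le_0_iff)
    ultimately show ?thesis by simp
  qed
  show "(1 - t / z) * u 0 \<le> u t" if t: "0 \<le> t" "t \<le> z" for t
  proof -
    obtain \<xi>1 where 1: "0 \<le> \<xi>1" "\<xi>1 \<le> t" "u t - u 0 = t * V \<xi>1" using mvt[of 0 t] t z by auto
    obtain \<xi>2 where 2: "t \<le> \<xi>2" "\<xi>2 \<le> z" "u z - u t = (z - t) * V \<xi>2" using mvt[of t z] t z by auto
    have "t * ((z - t) * V \<xi>2) \<le> t * ((z - t) * V \<xi>1)"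
      using left[of \<xi>1 \<xi>2] 1 2 t by (intro mult_left_mono) auto
    moreover have "t * ((z - t) * V \<xi>1) = (z - t) * (u t - u 0)" using 1 by simp
    ultimately have "t * (u z - u t) \<le> (z - t) * (u t - u 0)" using 2 by simp
    moreover have "t * u z \<ge> 0" using t z u_nonneg[of z] by simp
    ultimately have "(z - t) * u 0 \<le> z * u t" by (simp add: algebra_simps)
    then show ?thesis using z by (simp add: field_simps)
  qed
qed

text \<open>
  The three-step contradiction argument, carried out for a single solution and a threshold for \<open>lam\<close>
  that depends only on \<open>a\<close>, \<open>f\<close> and \<open>\<delta>\<close>.
\<close>

lemma positive_solution_is_small_if_lambda_is_large:
  fixes a f :: "real \<Rightarrow> real" and z A B \<eta> x\<^sub>\<omega> h q M \<delta> :: real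
  assumes a_Linf: "a \<in> L_infinity {0<..<1}"
    and a_int: "(LINT x:{0<..<1}|lebesgue. a x) < 0"
    and z: "z \<in> {0<..<1}"
    and a_pos: "AE x\<in>{0<..<z} in lebesgue. a x > 0"
    and a_neg: "AE x\<in>{z<..<1} in lebesgue. a x < 0"
    and AB: "A > 0" "B > 0" "\<eta> > 0"
    and a_left: "AE x\<in>{z - \<eta><..<z} \<inter> {0<..<1} in lebesgue. a x \<ge> A"
    and a_right: "AE x\<in>{z<..<z + \<eta>} \<inter> {0<..<1} in lebesgue. a x \<le> - B"
    and x\<^sub>\<omega>: "x\<^sub>\<omega> \<in> {z<..<1}" "(LINT x:{0<..<x\<^sub>\<omega>}|lebesgue. a x) = 0"
    and a_esssup: "\<forall>\<^sub>F \<epsilon> in at_right 0.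
           esssup (lebesgue_on {z + \<epsilon>..x\<^sub>\<omega>}) (\<lambda>x. ereal (a x)) < 0"
    and f_cont: "continuous_on UNIV f"
    and f0: "f 0 = 0"
    and f_pos: "\<And>u. u > 0 \<Longrightarrow> f u > 0"
    and hq: "h > 0" "q \<in> {0<..<1}"
    and f_inf: "((\<lambda>u. f u / u powr (- q)) \<longlongrightarrow> h) at_top"
    and M: "M > 0"
    and f_decr: "strict_antimono_on {M<..} f"
    and \<delta>: "\<delta> > 0"
  shows "\<forall>\<^sub>F lam in at_top. \<forall>u. positive_regular_solution a f lam u \<longrightarrow> u 0 < \<delta>"
proof -
  have f_nonneg: "f r \<ge> 0" if "r \<ge> 0" for r
    using f_pos[of r] f0 that by (cases "r = 0") (auto simp: less_imp_le)
  have z01: "0 < z" "z < 1" and xw: "z < x\<^sub>\<omega>" "x\<^sub>\<omega> < 1" using z x\<^sub>\<omega> by auto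
  have a_ai: "a absolutely_integrable_on {0..1}" by (rule absolutely_integrable_L_infinity[OF a_Linf])
  have ai: "a integrable_on {x..y}" if "0 \<le> x" "y \<le> 1" for x y
    using a_ai that integrable_on_subinterval[of a "{0..1}" x y] by (auto simp: absolutely_integrable_on_def)
  have LINT: "(LINT x:{0<..<t}|lebesgue. a x) = integral {0..t} a" if "0 \<le> t" "t \<le> 1" for t
  proof -
    have "a absolutely_integrable_on {0<..<t}"
      by (rule set_integrable_subset[OF a_ai]) (use that in auto)
    then show ?thesis
      using set_lebesgue_integral_eq_integral(2) by (metis integral_open_interval_real)
  qed
  have int_0w: "integral {0..x\<^sub>\<omega>} a = 0" using LINT[of x\<^sub>\<omega>] xw z01 x\<^sub>\<omega>(2) by simp
  have int_w1: "integral {x\<^sub>\<omega>..1} a < 0"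
    using LINT[of 1] a_int int_0w Henstock_Kurzweil_Integration.integral_combine[of 0 x\<^sub>\<omega> 1 a] xw z01 ai[of 0 1] by simp

  \<comment> \<open>The bound \<open>A \<le> a\<close> holds on \<open>{t\<^sub>1..z}\<close>;
    \<open>{t\<^sub>1..t}\<close> is used to bound \<open>u 0\<close> below and \<open>{t..z}\<close>
    for the energy estimate.\<close>
  define t\<^sub>1 where "t\<^sub>1 = max 0 (z - \<eta>)"
  define t where "t = (t\<^sub>1 + z) / 2"
  have t: "0 \<le> t\<^sub>1" "t\<^sub>1 < t" "t < z" using z01 AB by (auto simp: t\<^sub>1_def t_def)
  define \<kappa> where "\<kappa> = 1 - t / z"
  have \<kappa>: "\<kappa> > 0" using t z01 by (simp add: \<kappa>_def)
  have aA: "AE x\<in>{t\<^sub>1..z} in lebesgue. A \<le> a x"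
    by (rule AE_on_Icc_if_Ioo) (use a_left in \<open>eventually_elim, use z01 in \<open>auto simp: t\<^sub>1_def\<close>\<close>)
  have a0z: "AE x\<in>{0..z} in lebesgue. 0 \<le> a x"
    by (rule AE_on_Icc_if_Ioo) (use a_pos in \<open>eventually_elim, auto\<close>)
  have az1: "AE x\<in>{z..1} in lebesgue. a x \<le> 0"
    by (rule AE_on_Icc_if_Ioo) (use a_neg in \<open>eventually_elim, auto\<close>)
  \<comment> \<open>On \<open>{z..z + \<epsilon>}\<close> the bound \<open>- B\<close> is available,
    and on \<open>{z + \<epsilon>..x\<^sub>\<omega>}\<close> the negative essential supremum.\<close>
  obtain c where c: "c > 0" and ac: "AE x\<in>{z..x\<^sub>\<omega>} in lebesgue. a x \<le> - c"
  proof -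
    have "\<forall>\<^sub>F \<epsilon> in at_right 0. esssup (lebesgue_on {z + \<epsilon>..x\<^sub>\<omega>}) (\<lambda>x. ereal (a x)) < 0 \<and> 0 < \<epsilon> \<and> \<epsilon> < \<eta>"
      using a_esssup AB(3)
      by (auto simp: eventually_conj_iff eventually_at_right_less eventually_at_right[OF AB(3)])
    then obtain \<epsilon> where \<epsilon>: "esssup (lebesgue_on {z + \<epsilon>..x\<^sub>\<omega>}) (\<lambda>x. ereal (a x)) < 0" "0 < \<epsilon>" "\<epsilon> < \<eta>"
      using eventually_happens'[OF trivial_limit_at_right_real] by blast
    obtain c' where c': "esssup (lebesgue_on {z + \<epsilon>..x\<^sub>\<omega>}) (\<lambda>x. ereal (a x)) < ereal c'" "ereal c' < 0"
      using ereal_dense2[OF \<epsilon>(1)] by blast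
    have "AE x in lebesgue_on {z + \<epsilon>..x\<^sub>\<omega>}. a x \<le> c'"
      using esssup_AE[of "\<lambda>x. ereal (a x)" "lebesgue_on {z + \<epsilon>..x\<^sub>\<omega>}"]
      by eventually_elim (use c'(1) in \<open>metis ereal_less_eq(3) less_imp_le order_trans\<close>)
    then have "AE x\<in>{z + \<epsilon>..x\<^sub>\<omega>} in lebesgue. a x \<le> c'"
      by (simp add: AE_restrict_space_iff)
    with a_right have "AE x\<in>{z<..<x\<^sub>\<omega>} in lebesgue. a x \<le> - min B (- c')"
    proof eventually_elim
      case (elim x)
      show ?case
      proof
        assume x: "x \<in> {z<..<x\<^sub>\<omega>}"
        show "a x \<le> - min B (- c')"
        proof (cases "x < z + \<eta>")
          case True
          then have "x \<in> {z<..<z + \<eta>} \<inter> {0<..<1}" using x xw z01 by simp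
          with elim show ?thesis by linarith
        next
          case False
          then have "x \<in> {z + \<epsilon>..x\<^sub>\<omega>}" using x \<epsilon> by simp
          with elim show ?thesis by linarith
        qed
      qed
    qed
    from AE_on_Icc_if_Ioo[OF this] show thesis
      using c'(2) AB(2) by (intro that[of "min B (- c')"]) auto
  qed

  define F where "F = (\<lambda>r. integral {0..r} f)"
  have F_deriv: "(F has_real_derivative f r) (at r within {0..})" if "0 \<le> r" for r
    unfolding F_def by (rule integral_has_derivative_on_halfline[OF f_cont that])
  have F_mono: "F r \<le> F s" if "0 \<le> r" "r \<le> s" for r s
    unfolding F_def using that f_nonneg
    by (intro integral_subset_le integrable_continuous_real continuous_on_subset[OF f_cont]) auto
  have "filterlim F at_top at_top"
    unfolding F_def using hq
    by (intro integral_at_top_if_slow_power_decay[OF f_cont f_nonneg _ _ _ f_inf]) auto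
  then have "\<forall>\<^sub>F r in at_top. F M + 1 / A + 1 / c < F r"
    by (simp add: filterlim_at_top_dense)
  then obtain R where R: "\<And>r. r \<ge> R \<Longrightarrow> F M + 1 / A + 1 / c < F r"
    by (auto simp: eventually_at_top_linorder)
  \<comment> \<open>If \<open>u 0\<close> exceeds \<open>K\<close>, then \<open>u t \<ge> R\<close>,
    so \<open>F\<close> can lose \<open>1 / A + 1 / c\<close> along \<open>u\<close> and still exceed
    \<open>F M\<close>.\<close>
  define K where "K = max \<delta> (R / \<kappa>)"
  have "\<kappa> * \<delta> > 0" using \<kappa> \<delta> by simp
  have "\<kappa> * \<delta> \<le> 1 * \<delta>" using t z01 \<delta> by (intro mult_right_mono) (auto simp: \<kappa>_def)
  then have nonempty: "{\<kappa> * \<delta>..K} \<noteq> {}" by (simp add: K_def)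
  obtain m where m: "m > 0" "\<And>r. r \<in> {\<kappa> * \<delta>..K} \<Longrightarrow> m \<le> f r"
  proof -
    obtain r where r: "r \<in> {\<kappa> * \<delta>..K}" "\<And>s. s \<in> {\<kappa> * \<delta>..K} \<Longrightarrow> f r \<le> f s"
      using continuous_attains_inf[OF compact_Icc nonempty continuous_on_subset[OF f_cont]] by blast
    then show ?thesis using that[of "f r"] f_pos[of r] \<open>\<kappa> * \<delta> > 0\<close> by auto
  qed
  have small: "u 0 < \<delta>"
    if lam: "lam \<ge> 1" "lam * (A * m * (t - t\<^sub>1)) \<ge> 1" and sol: "positive_regular_solution a f lam u" for lam u
  proof (rule ccontr)
    assume "\<not> u 0 < \<delta>"
    then have u0: "\<delta> \<le> u 0" by simp
    have u_nonneg: "0 \<le> u x" if "x \<in> {0..1}" for x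
      using sol that by (auto simp: positive_regular_solution_def)
    have "regular_solution a f lam u" using sol by (simp add: positive_regular_solution_def)
    then obtain V where Vc: "continuous_on {0..1} V"
      and u: "\<And>x. x \<in> {0..1} \<Longrightarrow> (u has_real_derivative V x) (at x within {0..1})"
      and V0: "V 0 = 0" and V1: "V 1 = 0"
      and eq: "\<And>x y. \<lbrakk>0 \<le> x; x \<le> y; y \<le> 1\<rbrakk> \<Longrightarrow>
        curvature_flux (V y) - curvature_flux (V x) = - lam * integral {x..y} (\<lambda>t. a t * f (u t))"
      by (rule regular_solution_is_C1) blast
    have uc: "continuous_on {0..1} u" by (rule DERIV_continuous_on[OF u])
    have fuc: "continuous_on {0..1} (\<lambda>x. f (u x))"
      by (rule continuous_on_compose2[OF f_cont uc]) auto
    have fu_nonneg: "f (u x) \<ge> 0" if "x \<in> {0..1}" for x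
      using f_nonneg u_nonneg that by blast
    have fui: "(\<lambda>t. k * f (u t)) integrable_on {x..y}" if "0 \<le> x" "y \<le> 1" for x y k
      by (intro integrable_continuous_real continuous_intros continuous_on_subset[OF fuc]) (use that in auto)
    have "(\<lambda>t. f (u t) * a t) absolutely_integrable_on {0..1}"
      using a_ai fuc
      by (intro absolutely_integrable_bounded_measurable_product_real)
         (auto intro!: continuous_imp_measurable_on_sets_lebesgue compact_imp_bounded compact_continuous_image)
    then have "(\<lambda>t. a t * f (u t)) integrable_on {0..1}"
      using set_lebesgue_integral_eq_integral(1) by (simp add: mult.commute)
    then have afi: "(\<lambda>t. a t * f (u t)) integrable_on {x..y}" if "0 \<le> x" "y \<le> 1" for x y
      using that integrable_on_subinterval[of _ "{0..1}" x y] by auto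
    have above: "k * integral {x..y} (\<lambda>t. f (u t)) \<le> integral {x..y} (\<lambda>t. a t * f (u t))"
      if "AE s\<in>S in lebesgue. k \<le> a s" "{x..y} \<subseteq> S" "0 \<le> x" "y \<le> 1" for S k x y
    proof -
      have "integral {x..y} (\<lambda>t. k * f (u t)) \<le> integral {x..y} (\<lambda>t. a t * f (u t))"
      proof (rule integral_le_if_AE_le[OF fui afi])
        show "AE s\<in>{x..y} in lebesgue. k * f (u s) \<le> a s * f (u s)"
          using that(1) by eventually_elim (use that fu_nonneg in \<open>auto intro!: mult_right_mono\<close>)
      qed (use that in auto)
      then show ?thesis by simp
    qed
    have below: "integral {x..y} (\<lambda>t. a t * f (u t)) \<le> k * integral {x..y} (\<lambda>t. f (u t))"
      if "AE s\<in>S in lebesgue. a s \<le> k" "{x..y} \<subseteq> S" "0 \<le> x" "y \<le> 1" for S k x y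
    proof -
      have "integral {x..y} (\<lambda>t. a t * f (u t)) \<le> integral {x..y} (\<lambda>t. k * f (u t))"
      proof (rule integral_le_if_AE_le[OF afi fui])
        show "AE s\<in>{x..y} in lebesgue. a s * f (u s) \<le> k * f (u s)"
          using that(1) by eventually_elim (use that fu_nonneg in \<open>auto intro!: mult_right_mono\<close>)
      qed (use that in auto)
      then show ?thesis by simp
    qed

    have V_left: "V y \<le> V x" if "0 \<le> x" "x \<le> y" "y \<le> z" for x y
    proof -
      have "0 \<le> lam * integral {x..y} (\<lambda>t. a t * f (u t))"
        using above[OF a0z, of x y] that z01 lam by (intro mult_nonneg_nonneg) auto
      then have "curvature_flux (V y) \<le> curvature_flux (V x)"
        using eq[of x y] that z01 by simp
      then show ?thesis using strict_mono_less_eq[OF strict_mono_curvature_flux] by blast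
    qed
    have V_right: "V x \<le> V y" if "z \<le> x" "x \<le> y" "y \<le> 1" for x y
    proof -
      have "0 \<le> lam * (- integral {x..y} (\<lambda>t. a t * f (u t)))"
        using below[OF az1, of x y] that z01 lam by (intro mult_nonneg_nonneg) auto
      then have "curvature_flux (V x) \<le> curvature_flux (V y)"
        using eq[of x y] that z01 by simp
      then show ?thesis using strict_mono_less_eq[OF strict_mono_curvature_flux] by blast
    qed
    note shape = slopes_of_positive_solution[OF z01 V0 V1 u u_nonneg V_left V_right]
    have V_le_0: "V x \<le> 0" if "x \<in> {0..1}" for x by (rule shape(1)) (use that in auto)
    have u_anti: "u y \<le> u x" if "0 \<le> x" "x \<le> y" "y \<le> 1" for x y by (rule shape(2)) (use that in auto)
    have u_concave: "(1 - s / z) * u 0 \<le> u s" if "0 \<le> s" "s \<le> z" for s by (rule shape(3)) (use that in auto)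
    have ut: "\<kappa> * u 0 \<le> u t" using u_concave[of t] t by (simp add: \<kappa>_def)

    \<comment> \<open>A bounded \<open>u 0\<close> would make the flux fall by 1 or more on
      \<open>{t\<^sub>1..t}\<close>.\<close>
    have "K < u 0"
    proof (rule ccontr)
      assume "\<not> K < u 0"
      have range: "u x \<in> {\<kappa> * \<delta>..K}" if "x \<in> {t\<^sub>1..t}" for x
      proof -
        have "\<kappa> * \<delta> \<le> \<kappa> * u 0" using \<kappa> u0 by simp
        then show ?thesis
          using ut u_anti[of x t] u_anti[of 0 x] that t z01 \<open>\<not> K < u 0\<close> by auto
      qed
      have "integral {t\<^sub>1..t} (\<lambda>_. m) \<le> integral {t\<^sub>1..t} (\<lambda>x. f (u x))"
        by (rule integral_le) (use fui[of t\<^sub>1 t 1] t z01 m range in auto)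
      then have "m * (t - t\<^sub>1) \<le> integral {t\<^sub>1..t} (\<lambda>x. f (u x))" using t by (simp add: mult.commute)
      then have "A * (m * (t - t\<^sub>1)) \<le> A * integral {t\<^sub>1..t} (\<lambda>x. f (u x))" using AB by simp
      also have "\<dots> \<le> integral {t\<^sub>1..t} (\<lambda>x. a x * f (u x))"
        by (rule above[OF aA]) (use t z01 in auto)
      finally have "lam * (A * m * (t - t\<^sub>1)) \<le> lam * integral {t\<^sub>1..t} (\<lambda>x. a x * f (u x))"
        using lam by (intro mult_left_mono) (auto simp: mult.assoc)
      then have "1 \<le> curvature_flux (V t\<^sub>1) - curvature_flux (V t)"
        using eq[of t\<^sub>1 t] t z01 lam(2) by simp
      moreover have "curvature_flux (V t\<^sub>1) \<le> curvature_flux 0"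
        unfolding strict_mono_less_eq[OF strict_mono_curvature_flux] using V_le_0[of t\<^sub>1] t z01 by simp
      ultimately show False using curvature_flux_gt_minus_1[of "V t"] by simp
    qed

    define E where "E = (\<lambda>x. 1 / sqrt (1 + (V x)\<^sup>2))"
    have E_range: "0 < E x" "E x \<le> 1" for x
      unfolding E_def using one_plus_square_pos[of "V x"] by auto
    have energy: "k * (F (u x) - F (u y)) \<le> s * (E y - E x)"
      if "0 \<le> x" "x \<le> y" "y \<le> 1" and
        "\<And>x' y'. \<lbrakk>x \<le> x'; x' \<le> y'; y' \<le> y\<rbrakk> \<Longrightarrow>
          k * integral {x'..y'} (\<lambda>t. f (u t)) \<le> s * (curvature_flux (V y') - curvature_flux (V x'))"
      for x y k s
      unfolding E_def using that u_nonneg V_le_0 F_deriv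
      by (intro energy_inequality[OF _ continuous_on_subset[OF Vc] _ DERIV_subset[OF u] _ f_cont]) auto
    have quotient: "r \<le> 1 / k" if "lam * k * r \<le> 1" "k > 0" for k r
    proof -
      have "k * r \<le> 1"
      proof (rule ccontr)
        assume "\<not> k * r \<le> 1"
        then have "1 * (k * r) \<le> lam * (k * r)" using lam by (intro mult_right_mono) auto
        moreover have "lam * (k * r) \<le> 1" using that(1) by (simp only: mult.assoc)
        ultimately show False using \<open>\<not> k * r \<le> 1\<close> by linarith
      qed
      then show ?thesis using that by (simp add: field_simps)
    qed
    \<comment> \<open>Since \<open>E\<close> stays between 0 and 1, the two drops of
      \<open>F\<close> along \<open>u\<close> are bounded independently of \<open>u 0\<close>.\<close>
    have drop_left: "F (u t) - F (u z) \<le> 1 / A"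
    proof (rule quotient[OF _ AB(1)])
      have "lam * A * (F (u t) - F (u z)) \<le> (- 1) * (E z - E t)"
      proof (rule energy)
        fix x' y' assume *: "t \<le> x'" "x' \<le> y'" "y' \<le> z"
        then have "lam * (A * integral {x'..y'} (\<lambda>t. f (u t))) \<le> lam * integral {x'..y'} (\<lambda>t. a t * f (u t))"
          using t z01 lam by (intro mult_left_mono above[OF aA]) auto
        then show "lam * A * integral {x'..y'} (\<lambda>t. f (u t)) \<le> (- 1) * (curvature_flux (V y') - curvature_flux (V x'))"
          using eq[of x' y'] * t z01 by simp
      qed (use t z01 in auto)
      then show "lam * A * (F (u t) - F (u z)) \<le> 1"
        by (rule order_trans) (use E_range[of t] E_range[of z] in simp)
    qed
    have drop_right: "F (u z) - F (u x\<^sub>\<omega>) \<le> 1 / c"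
    proof (rule quotient[OF _ c])
      have "lam * c * (F (u z) - F (u x\<^sub>\<omega>)) \<le> 1 * (E x\<^sub>\<omega> - E z)"
      proof (rule energy)
        fix x' y' assume *: "z \<le> x'" "x' \<le> y'" "y' \<le> x\<^sub>\<omega>"
        then have "lam * integral {x'..y'} (\<lambda>t. a t * f (u t)) \<le> lam * (- c * integral {x'..y'} (\<lambda>t. f (u t)))"
          using xw z01 lam by (intro mult_left_mono below[OF ac]) auto
        then show "lam * c * integral {x'..y'} (\<lambda>t. f (u t)) \<le> 1 * (curvature_flux (V y') - curvature_flux (V x'))"
          using eq[of x' y'] * xw z01 by simp
      qed (use xw z01 in auto)
      then show "lam * c * (F (u z) - F (u x\<^sub>\<omega>)) \<le> 1"
        by (rule order_trans) (use E_range[of z] E_range[of x\<^sub>\<omega>] in simp)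
    qed
    have "R \<le> \<kappa> * u 0"
      using \<open>K < u 0\<close> \<kappa> by (simp add: K_def field_simps)
    then have "F M + 1 / A + 1 / c < F (u t)" using ut R by simp
    then have "F M < F (u x\<^sub>\<omega>)" using drop_left drop_right by simp
    then have uw: "M < u x\<^sub>\<omega>"
      using F_mono[of "u x\<^sub>\<omega>" M] u_nonneg[of x\<^sub>\<omega>] xw z01 by force

    have f_anti: "f r \<le> f s" if "M < s" "s \<le> r" for r s
      using f_decr that by (cases "s = r") (auto simp: monotone_on_def less_imp_le)
    \<comment> \<open>To the left of \<open>z\<close> both \<open>a \<ge> 0\<close> and \<open>f (u
      s) \<le> f (u z)\<close>; to the right both inequalities are reversed.\<close>
    have "integral {0..x\<^sub>\<omega>} (\<lambda>s. a s * f (u s)) \<le> integral {0..x\<^sub>\<omega>} (\<lambda>s. a s * f (u z))"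
    proof (rule integral_le_if_AE_le)
      show "(\<lambda>s. a s * f (u s)) integrable_on {0..x\<^sub>\<omega>}" using afi xw by simp
      show "(\<lambda>s. a s * f (u z)) integrable_on {0..x\<^sub>\<omega>}"
        using ai xw by (intro integrable_on_mult_left) simp
      show "AE s\<in>{0..x\<^sub>\<omega>} in lebesgue. a s * f (u s) \<le> a s * f (u z)"
        using a0z az1
      proof eventually_elim
        case (elim s)
        show ?case
        proof
          assume s: "s \<in> {0..x\<^sub>\<omega>}"
          show "a s * f (u s) \<le> a s * f (u z)"
          proof (cases "s \<le> z")
            case True
            then have "f (u s) \<le> f (u z)"
              using s u_anti[of s z] u_anti[of z x\<^sub>\<omega>] uw xw z01 by (intro f_anti) auto
            then show ?thesis using elim s True by (intro mult_left_mono) auto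
          next
            case False
            then have "f (u z) \<le> f (u s)"
              using s u_anti[of z s] u_anti[of s x\<^sub>\<omega>] uw xw z01 by (intro f_anti) auto
            then show ?thesis using elim s False xw by (intro mult_left_mono_neg) auto
          qed
        qed
      qed
    qed
    also have "\<dots> = 0" using int_0w by simp
    finally have "0 \<le> curvature_flux (V x\<^sub>\<omega>)"
      using eq[of 0 x\<^sub>\<omega>] xw z01 lam by (simp add: V0 mult_le_0_iff)
    then have "curvature_flux 0 \<le> curvature_flux (V x\<^sub>\<omega>)" by simp
    then have "0 \<le> V x\<^sub>\<omega>"
      using strict_mono_less_eq[OF strict_mono_curvature_flux] by blast
    then have V_zero: "V x = 0" if "x \<in> {x\<^sub>\<omega>..1}" for x
      using V_right[of x\<^sub>\<omega> x] V_le_0[of x] that xw z01 by auto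
    \<comment> \<open>The flux is squeezed to 0 on \<open>{x\<^sub>\<omega>..1}\<close>, so
      \<open>u\<close> is constant there.\<close>
    obtain l where "\<forall>x\<in>{x\<^sub>\<omega>..1}. u x = l"
    proof -
      have "(u has_real_derivative 0) (at y within {x\<^sub>\<omega>..1})" if "y \<in> {x\<^sub>\<omega>..1}" for y
        using DERIV_subset[OF u[of y], of "{x\<^sub>\<omega>..1}"] V_zero[of y] that xw z01 by auto
      then show thesis
        using that has_field_derivative_zero_constant[of "{x\<^sub>\<omega>..1}" u] by auto
    qed
    then have u_const: "u x = u x\<^sub>\<omega>" if "x \<in> {x\<^sub>\<omega>..1}" for x
      using that xw by auto
    have "integral {x\<^sub>\<omega>..1} (\<lambda>s. a s * f (u s)) = integral {x\<^sub>\<omega>..1} (\<lambda>s. a s * f (u x\<^sub>\<omega>))"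
      by (rule Henstock_Kurzweil_Integration.integral_cong) (metis u_const)
    then have "lam * (integral {x\<^sub>\<omega>..1} a * f (u x\<^sub>\<omega>)) = 0"
      using eq[of x\<^sub>\<omega> 1] V_zero[of x\<^sub>\<omega>] V1 xw z01 by simp
    moreover have "f (u x\<^sub>\<omega>) > 0" using f_pos uw M by simp
    ultimately show False using int_w1 lam by simp
  qed
  have large: "\<forall>\<^sub>F lam in at_top. lam \<ge> 1 \<and> lam * (A * m * (t - t\<^sub>1)) \<ge> (1::real)"
  proof (intro eventually_conj eventually_ge_at_top)
    have pos: "A * m * (t - t\<^sub>1) > 0" using AB m t by simp
    show "\<forall>\<^sub>F lam in at_top. lam * (A * m * (t - t\<^sub>1)) \<ge> 1"
      using eventually_ge_at_top[of "1 / (A * m * (t - t\<^sub>1))"] by eventually_elim (use pos in \<open>simp only: pos_divide_le_eq\<close>)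
  qed
  show ?thesis
    by (rule eventually_mono[OF large]) (use small in blast)
qed

theorem theorem7p4:
  fixes a f :: "real \<Rightarrow> real" and z A B \<eta> x\<^sub>\<omega> h p q M :: real
  assumes a_Linf: "a \<in> L_infinity {0<..<1}"
    and a_int: "(LINT x:{0<..<1}|lebesgue. a x) < 0"
    and z: "z \<in> {0<..<1}"
    and a_pos: "AE x\<in>{0<..<z} in lebesgue. a x > 0"
    and a_neg: "AE x\<in>{z<..<1} in lebesgue. a x < 0"
    and AB: "A > 0" "B > 0" "\<eta> > 0"
    and a_left: "AE x\<in>{z - \<eta><..<z} \<inter> {0<..<1} in lebesgue. a x \<ge> A"
    and a_right: "AE x\<in>{z<..<z + \<eta>} \<inter> {0<..<1} in lebesgue. a x \<le> - B"
    and x\<^sub>\<omega>: "x\<^sub>\<omega> \<in> {z<..<1}" "(LINT x:{0<..<x\<^sub>\<omega>}|lebesgue. a x) = 0"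
    and a_esssup: "\<forall>\<^sub>F \<epsilon> in at_right 0.
           esssup (lebesgue_on {z + \<epsilon>..x\<^sub>\<omega>}) (\<lambda>x. ereal (a x)) < 0"
    and f_cont: "continuous_on UNIV f"
    and f0: "f 0 = 0"
    and f_pos: "\<And>u. u > 0 \<Longrightarrow> f u > 0"
    and hpq: "h > 0" "p > 0" "q \<in> {0<..<1}"
    and f_zero: "((\<lambda>u. f u / u powr p) \<longlongrightarrow> 1) (at_right 0)"
    and f_inf: "((\<lambda>u. f u / u powr (- q)) \<longlongrightarrow> h) at_top"
    and M: "M > 0" "\<And>u. u \<ge> 0 \<Longrightarrow> f u \<le> f M" "\<And>u. u \<ge> 0 \<Longrightarrow> f u = f M \<Longrightarrow> u \<le> M"
    and f_C1: "\<exists>f'. continuous_on {M..} f' \<and>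
           (\<forall>u\<in>{M..}. (f has_real_derivative f' u) (at u within {M..}))"
    and f_incr: "strict_mono_on {0<..<M} f"
    and f_decr: "strict_antimono_on {M<..} f"
  shows "\<not> (\<exists>(lam :: nat \<Rightarrow> real) (u :: nat \<Rightarrow> real \<Rightarrow> real).
             (\<forall>n. positive_regular_solution a f (lam n) (u n)) \<and>
             filterlim lam at_top sequentially \<and>
             liminf (\<lambda>n. ereal (u n 0)) > 0)"
proof (rule notI, elim exE conjE)
  fix lam :: "nat \<Rightarrow> real" and u :: "nat \<Rightarrow> real \<Rightarrow> real"
  assume sol: "\<forall>n. positive_regular_solution a f (lam n) (u n)"
    and lam: "filterlim lam at_top sequentially"
    and away: "liminf (\<lambda>n. ereal (u n 0)) > 0"
  obtain \<delta> where \<delta>: "0 < ereal \<delta>" "ereal \<delta> < liminf (\<lambda>n. ereal (u n 0))"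
    using ereal_dense2[OF away] by blast
  have "\<forall>\<^sub>F n in sequentially. ereal \<delta> < ereal (u n 0)"
    using less_LiminfD[OF \<delta>(2)] .
  moreover have "\<forall>\<^sub>F n in sequentially. \<forall>v. positive_regular_solution a f (lam n) v \<longrightarrow> v 0 < \<delta>"
  proof (rule eventually_compose_filterlim[OF _ lam])
    show "\<forall>\<^sub>F l in at_top. \<forall>v. positive_regular_solution a f l v \<longrightarrow> v 0 < \<delta>"
      by (rule positive_solution_is_small_if_lambda_is_large[OF a_Linf a_int z a_pos a_neg AB
            a_left a_right x\<^sub>\<omega> a_esssup f_cont f0 f_pos hpq(1,3) f_inf M(1) f_decr])
         (use \<delta> in auto)
  qed
  ultimately have "\<forall>\<^sub>F n in sequentially. False"
    by eventually_elim (use sol in \<open>simp add: less_le_not_le\<close>)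
  then show False by simp
qed

end
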